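(* Let $\Theta\subset\mathbb{R}^p$ be a nonempty connected open set, $\alpha>0$, $\beta>0$. For each $\theta\in\Theta$ let $g_\theta:\mathbb{R}^n\to\mathbb{R}\cup\{+\infty\}$ and $f^*_\theta:\mathbb{R}^m\to\mathbb{R}\cup\{+\infty\}$ be closed, proper, $\alpha$-strongly convex, and $K_\theta\in\mathbb{R}^{m\times n}$ with $0<\|K_\theta\|_{\mathrm{op}}\le\beta$. Let $\gamma\in\big(0,\frac{2\alpha}{(\alpha+\beta)^2}\big)$ and assume that $T(\theta,u,v):=\big(\mathrm{prox}_{\gamma g_\theta}(u),\mathrm{prox}_{\gamma f^*_\theta}(v)\big)$ and $\mathcal{B}(\theta,x,y):=(K_\theta^*y,\,-K_\theta x)$ are path differentiable jointly in $(\theta,x,y)\in\Theta\times\mathbb{R}^n\times\mathbb{R}^m$. Then for each $\theta$ the problem $\min_{x}\max_{y}\ g_\theta(x)+\langle K_\theta x,y\rangle-f_\theta^*(y)$ has a unique saddle point $z^\star(\theta)=(x^\star(\theta),y^\star(\theta))$, characterized by $K_\theta x^\star\in\partial f^*_\theta(y^\star)$ and $-K_\theta^* y^\star\in\partial g_\theta(x^\star)$, and $\theta\mapsto z^\star(\theta)$ is path differentiable on $\Theta$ with conservative Jacobian $$\mathcal{J}_{z^\star}(\theta)=\Big\{\big(\mathrm{Id}_{n+m}-V(\mathrm{Id}_{n+m}-\gamma Z)\big)^{-1}\big(U-\gamma VW\big):[U\ V]\in\mathrm{Jac}^c_T\big(\theta,\,x^\star(\theta)-\gamma K_\theta^*y^\star(\theta),\,y^\star(\theta)+\gamma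 K_\theta x^\star(\theta)\big),\ [W\ Z]\in\mathrm{Jac}^c_{\mathcal{B}}(\theta,x^\star(\theta),y^\star(\theta))\Big\}.$$
   Context: $\mathrm{prox}_g(x)=\mathrm{argmin}_u\, g(u)+\frac12\|x-u\|^2$; $\partial$ is the convex subdifferential. Clarke Jacobian: for a locally Lipschitz $F:\mathbb{R}^N\to\mathbb{R}^k$, $\mathrm{Jac}^c_F(z)=\mathrm{conv}\{\lim_j \mathrm{Jac}_F(z_j): z_j\to z,\ F \text{ differentiable at } z_j\}$. A conservative Jacobian for a locally Lipschitz $F$ is a set-valued map $\mathcal{J}_F$ with nonempty values, locally bounded, with closed graph, such that for every absolutely continuous curve $c:[0,1]\to\mathbb{R}^N$, for almost every $t$, $\frac{d}{dt}F(c(t))=M\dot c(t)$ for all $M\in\mathcal{J}_F(c(t))$. $F$ is path differentiable if it is locally Lipschitz and admits a conservative Jacobian. Jacobians of maps of $(\theta,z)$, $z\in\mathbb{R}^{n+m}$, are written $[U\ V]$ with $U$ the $\theta$-block and $V$ the $z$-block of the joint Jacobian. *)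

theory Defs
  imports "HOL-Analysis.Analysis" "HOL-Library.Extended_Real"
begin

definition closed_fun :: "('a::topological_space \<Rightarrow> ereal) \<Rightarrow> bool" where
  "closed_fun g \<longleftrightarrow> closed {(x, t::real). g x \<le> ereal t}"

definition proper_fun :: "('a \<Rightarrow> ereal) \<Rightarrow> bool" where
  "proper_fun g \<longleftrightarrow> (\<forall>x. g x \<noteq> -\<infinity>) \<and> (\<exists>x. g x \<noteq> \<infinity>)"

definition strongly_convex :: "real \<Rightarrow> ('a::real_normed_vector \<Rightarrow> ereal) \<Rightarrow> bool" where
  "strongly_convex \<alpha> g \<longleftrightarrow>
     (\<forall>x y. \<forall>t\<in>{0..1}.
        g (t *\<^sub>R x + (1 - t) *\<^sub>R y)
          \<le> ereal t * g x + ereal (1 - t) * g y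
             - ereal (\<alpha> / 2 * t * (1 - t) * (norm (x - y))\<^sup>2))"

definition prox :: "('a::real_normed_vector \<Rightarrow> ereal) \<Rightarrow> 'a \<Rightarrow> 'a" where
  "prox g x = (THE u. \<forall>v. g u + ereal ((norm (x - u))\<^sup>2 / 2) \<le> g v + ereal ((norm (x - v))\<^sup>2 / 2))"

definition subdiff :: "('a::real_inner \<Rightarrow> ereal) \<Rightarrow> 'a \<Rightarrow> 'a set" where
  "subdiff g x = {s. \<forall>y. g x + ereal (s \<bullet> (y - x)) \<le> g y}"

definition vjoin :: "real^'a \<Rightarrow> real^'b \<Rightarrow> real^('a + 'b)" where
  "vjoin u v = (\<chi> i. case i of Inl a \<Rightarrow> u $ a | Inr b \<Rightarrow> v $ b)"

definition vfst :: "real^('a::finite + 'b::finite) \<Rightarrow> real^'a" where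
  "vfst w = (\<chi> a. w $ Inl a)"

definition vsnd :: "real^('a::finite + 'b::finite) \<Rightarrow> real^'b" where
  "vsnd w = (\<chi> b. w $ Inr b)"

definition mblockL :: "real^('a::finite + 'b::finite)^'c \<Rightarrow> real^'a^'c" where
  "mblockL M = (\<chi> i j. M $ i $ Inl j)"

definition mblockR :: "real^('a::finite + 'b::finite)^'c \<Rightarrow> real^'b^'c" where
  "mblockR M = (\<chi> i j. M $ i $ Inr j)"

definition clarke_jac :: "(real^'a \<Rightarrow> real^'b) \<Rightarrow> real^'a \<Rightarrow> (real^'a^'b) set" where
  "clarke_jac F z = convex hull
     {M. \<exists>zs. zs \<longlonglongrightarrow> z \<and> (\<forall>j. F differentiable (at (zs j)))
              \<and> (\<lambda>j. jacobian F (at (zs j))) \<longlonglongrightarrow> M}"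

definition abs_continuous_curve :: "(real \<Rightarrow> 'a::real_normed_vector) \<Rightarrow> bool" where
  "abs_continuous_curve c \<longleftrightarrow>
     (\<forall>\<epsilon>>0. \<exists>\<delta>>0. \<forall>(n::nat) (a::nat \<Rightarrow> real) b.
        (\<forall>i<n. 0 \<le> a i \<and> a i \<le> b i \<and> b i \<le> 1)
        \<and> (\<forall>i<n. \<forall>j<n. i \<noteq> j \<longrightarrow> b i \<le> a j \<or> b j \<le> a i)
        \<and> (\<Sum>i<n. b i - a i) < \<delta>
        \<longrightarrow> (\<Sum>i<n. norm (c (b i) - c (a i))) < \<epsilon>)"

definition loc_lipschitz_on :: "'a::metric_space set \<Rightarrow> ('a \<Rightarrow> 'b::metric_space) \<Rightarrow> bool" where
  "loc_lipschitz_on D F \<longleftrightarrow> (\<forall>x\<in>D. \<exists>e>0. \<exists>L. lipschitz_on L (ball x e \<inter> D) F)"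

definition conservative_jac_on ::
  "(real^'a) set \<Rightarrow> (real^'a \<Rightarrow> real^'b) \<Rightarrow> (real^'a \<Rightarrow> (real^'a^'b) set) \<Rightarrow> bool" where
  "conservative_jac_on D F J \<longleftrightarrow>
     (\<forall>z\<in>D. J z \<noteq> {})
     \<and> (\<forall>z\<in>D. \<exists>e>0. bounded (\<Union>w\<in>ball z e \<inter> D. J w))
     \<and> closedin (top_of_set (D \<times> UNIV)) {(z, M). z \<in> D \<and> M \<in> J z}
     \<and> (\<forall>c. abs_continuous_curve c \<and> c ` {0..1} \<subseteq> D \<longrightarrow>
          (AE t in lebesgue_on {0..1}.
             \<exists>c'. (c has_vector_derivative c') (at t)
               \<and> (\<forall>M\<in>J (c t). ((F \<circ> c) has_vector_derivative (M *v c')) (at t))))"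

definition path_differentiable_on :: "(real^'a) set \<Rightarrow> (real^'a \<Rightarrow> real^'b) \<Rightarrow> bool" where
  "path_differentiable_on D F \<longleftrightarrow> loc_lipschitz_on D F \<and> (\<exists>J. conservative_jac_on D F J)"

definition saddle_point ::
  "(real^'n \<Rightarrow> ereal) \<Rightarrow> real^'n^'m \<Rightarrow> (real^'m \<Rightarrow> ereal) \<Rightarrow> real^'n \<Rightarrow> real^'m \<Rightarrow> bool" where
  "saddle_point g K f x y \<longleftrightarrow>
     \<bar>g x\<bar> \<noteq> \<infinity> \<and> \<bar>f y\<bar> \<noteq> \<infinity> \<and>
     (\<forall>x' y'. g x + ereal ((K *v x) \<bullet> y') - f y' \<le> g x + ereal ((K *v x) \<bullet> y) - f y
            \<and> g x + ereal ((K *v x) \<bullet> y) - f y \<le> g x' + ereal ((K *v x') \<bullet> y) - f y)"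

end

theory Submission
  imports Defs
begin

text \<open>
  A saddle point is exactly a fixed point \<open>z = T (\<theta>, z - \<gamma> B (\<theta>, z))\<close> of the forward-backward map.
  Strong convexity makes \<open>T\<close> a contraction in \<open>z\<close> with factor \<open>1 / (1 + \<gamma> \<alpha>)\<close>, and since \<open>B\<close> is skew in
  \<open>z\<close> the forward step expands by at most \<open>sqrt (1 + \<gamma>\<^sup>2 \<beta>\<^sup>2)\<close>; the step size bound makes the product less
  than \<open>1\<close>. This gives existence, uniqueness and local Lipschitz dependence on \<open>\<theta>\<close>, and, because the
  same bounds hold for the \<open>z\<close>-blocks of Clarke Jacobians, invertibility of \<open>Id - V (Id - \<gamma> Z)\<close>.
  Differentiating the fixed point equation along an absolutely continuous curve then yields the formula.

  The chain rule along curves is available because the Clarke Jacobian of any path differentiable map is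
  itself conservative. If \<open>J\<close> is some conservative Jacobian of \<open>F\<close>, integrating along segments bounds the
  difference quotients of \<open>F\<close> in direction \<open>v\<close> by nearby values of \<open>J v\<close>. Hence if all elements of \<open>J z\<close>
  agree on \<open>v\<close>, so do all elements of the Clarke Jacobian at \<open>z\<close>, and this happens at almost every point
  of a curve with \<open>v\<close> its velocity. The Clarke Jacobian is nonempty because \<open>J\<close> is single-valued, and so
  \<open>F\<close> differentiable, on a dense set.
\<close>

section \<open>Mean value inequality and absolutely continuous curves\<close>

text \<open>The hypotheses on \<open>T\<close> and \<open>B\<close> are joint in parameter and
  point, whereas the contraction estimates hold at a fixed parameter. The link is to test Clarke
  Jacobians on vectors \<open>vjoin 0 v\<close>: a closed convex constraint on nearby difference
  quotients in that direction is inherited by every Clarke element. For \<open>B\<close> this forces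
  the point block to be \<open>B\<close> at that parameter, so skewness survives and the product of
  the two blocks keeps the factor \<open>q\<close>.

  The resulting lower bound \<open>(1 - q) * norm v\<close> for the implicit matrix is uniform over
  all pairs of Clarke elements. It serves twice: for invertibility, and for local boundedness and
  closed graph of the formula, where it replaces continuity of matrix inversion.

  A conservative Jacobian speaks of one curve at a time and leaves out a null set of times. Local
  Lipschitz dependence of \<open>zstar\<close> therefore comes before any differentiation: it makes
  the curve of pairs (parameter, saddle point) and its image under \<open>fwd\<close> absolutely
  continuous, so that the chain rules of \<open>B\<close> and \<open>T\<close> can be used along
  them.\<close>

lemma bounded_bilinear_matrix_vector_mult:
  "bounded_bilinear ((*v) :: real^'a^'b \<Rightarrow> real^'a \<Rightarrow> real^'b)"
proof -
  have "bilinear ((*v) :: real^'a^'b \<Rightarrow> real^'a \<Rightarrow> real^'b)"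
    unfolding bilinear_def
    by (auto intro!: linearI simp: algebra_simps scaleR_matrix_vector_assoc)
  then show ?thesis
    by (simp add: bilinear_conv_bounded_bilinear)
qed

lemmas tendsto_matrix_vector_mult [tendsto_intros] =
  bounded_bilinear.tendsto [OF bounded_bilinear_matrix_vector_mult]

text \<open>If the inequality fails, tilt \<open>\<phi>\<close> so that its derivative is negative off a null set \<open>N\<close> although it
  increases overall. The Lipschitz image of \<open>N\<close> is null, so some intermediate value is not attained on
  \<open>N\<close>; at the last time the tilted function is below that value its derivative cannot be negative.\<close>

lemma mean_value_ineq_AE_real:
  fixes \<phi> :: "real \<Rightarrow> real"
  assumes lip: "L-lipschitz_on {0..1} \<phi>"
    and der: "AE t in lebesgue_on {0..1}. \<exists>d\<le>C. (\<phi> has_real_derivative d) (at t)"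
  shows "\<phi> 1 - \<phi> 0 \<le> C"
proof (rule ccontr)
  assume "\<not> \<phi> 1 - \<phi> 0 \<le> C"
  then obtain C' where C': "C < C'" "C' < \<phi> 1 - \<phi> 0"
    using dense by (metis not_le)
  define \<psi> where "\<psi> = (\<lambda>t. \<phi> t - C' * t)"
  have lip\<psi>: "(L + \<bar>C'\<bar>)-lipschitz_on {0..1} \<psi>"
  proof -
    have "\<bar>C'\<bar>-lipschitz_on {0..1} (\<lambda>t. C' * t)"
      by (rule lipschitz_onI) (auto simp: dist_real_def abs_mult[symmetric] algebra_simps)
    then show ?thesis
      using lip unfolding \<psi>_def by (intro lipschitz_intros)
  qed
  then have cont: "continuous_on {0..1} \<psi>"
    by (rule lipschitz_on_continuous_on)
  define N where "N = {t \<in> {0..1}. \<not> (\<exists>d<0. (\<psi> has_real_derivative d) (at t))}"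
  have "negligible N"
  proof -
    have "AE t in lebesgue. t \<in> {0..1} \<longrightarrow> (\<exists>d\<le>C. (\<phi> has_real_derivative d) (at t))"
      using der by (subst (asm) AE_restrict_space_iff) auto
    then have "{t. \<not> (t \<in> {0..1} \<longrightarrow> (\<exists>d\<le>C. (\<phi> has_real_derivative d) (at t)))} \<in> null_sets lebesgue"
      by (simp add: completion.AE_iff_null_sets)
    moreover have "\<exists>d<0. (\<psi> has_real_derivative d) (at t)"
      if "d \<le> C" "(\<phi> has_real_derivative d) (at t)" for d t
      using that C' unfolding \<psi>_def
      by (intro exI[of _ "d - C'"] conjI) (auto intro!: derivative_eq_intros)
    then have "N \<subseteq> {t. \<not> (t \<in> {0..1} \<longrightarrow> (\<exists>d\<le>C. (\<phi> has_real_derivative d) (at t)))}"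
      unfolding N_def by blast
    ultimately show ?thesis
      using negligible_iff_null_sets negligible_subset by blast
  qed
  then have "negligible (\<psi> ` N)"
  proof (rule negligible_locally_Lipschitz_image[rotated])
    fix x assume "x \<in> N"
    then show "\<exists>T B. open T \<and> x \<in> T \<and> (\<forall>y\<in>N \<inter> T. norm (\<psi> y - \<psi> x) \<le> B * norm (y - x))"
      using lip\<psi> unfolding lipschitz_on_def dist_norm N_def
      by (intro exI[of _ UNIV] exI[of _ "L + \<bar>C'\<bar>"]) auto
  qed simp
  moreover have "\<not> negligible {\<psi> 0<..<\<psi> 1}"
    using C' open_not_negligible[of "{\<psi> 0<..<\<psi> 1}"] by (auto simp: \<psi>_def)
  ultimately obtain y where y: "\<psi> 0 < y" "y < \<psi> 1" "y \<notin> \<psi> ` N"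
    using negligible_subset by (metis greaterThanLessThan_iff subsetI)
  define A where "A = {t \<in> {0..1}. \<psi> t \<le> y}"
  have "compact A"
    unfolding A_def using continuous_closed_preimage[OF cont, of "{..y}"]
    by (auto simp: compact_eq_bounded_closed vimage_def Int_def intro: bounded_subset[OF bounded_closed_interval])
  moreover have "A \<noteq> {}"
    using y by (auto simp: A_def intro!: exI[of _ 0])
  ultimately obtain s where s: "s \<in> A" "\<And>t. t \<in> A \<Longrightarrow> t \<le> s"
    by (metis compact_attains_sup)
  have s01: "0 \<le> s" "s < 1" "\<psi> s \<le> y"
    using s(1) y by (auto simp: A_def less_le)
  obtain t where "s \<le> t" "t \<le> 1" "\<psi> t = y"
    using IVT'[of \<psi> s y 1] s01 y continuous_on_subset[OF cont, of "{s..1}"] by auto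
  then have "t \<in> A"
    using s01 by (auto simp: A_def)
  then have "\<psi> s = y"
    using s(2)[of t] \<open>s \<le> t\<close> \<open>\<psi> t = y\<close> by auto
  then have "s \<notin> N"
    using y by auto
  then obtain d where "d < 0" "(\<psi> has_real_derivative d) (at s)"
    using s01 by (auto simp: N_def)
  then obtain e where e: "e > 0" "\<And>h. 0 < h \<Longrightarrow> h < e \<Longrightarrow> \<psi> (s + h) < \<psi> s"
    using DERIV_neg_dec_right by blast
  define h where "h = min (e/2) (1 - s)"
  have "0 < h" "h < e" "s + h \<le> 1"
    using e s01 by (auto simp: h_def min_def)
  then have "s + h \<in> A"
    using e(2)[of h] s01 by (auto simp: A_def \<open>\<psi> s = y\<close>)
  then show False
    using s(2) \<open>0 < h\<close> by force
qed

text \<open>Reduction to the scalar case: pairing with the unit vector \<open>u\<close> along the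
  error \<open>w\<close> turns \<open>norm w\<close> into \<open>w \<bullet> u\<close>, the quantity
  bounded by the real-valued inequality.\<close>

lemma mean_value_ineq_AE:
  fixes \<phi> :: "real \<Rightarrow> 'a::real_inner"
  assumes lip: "L-lipschitz_on {0..1} \<phi>"
    and der: "AE t in lebesgue_on {0..1}. \<exists>d. norm (d - r) \<le> e \<and> (\<phi> has_vector_derivative d) (at t)"
  shows "norm (\<phi> 1 - \<phi> 0 - r) \<le> e"
proof -
  define w where "w = \<phi> 1 - \<phi> 0 - r"
  define u where "u = sgn w"
  have un: "norm u \<le> 1"
    by (auto simp: u_def norm_sgn)
  have *: "(\<lambda>t. \<phi> t \<bullet> u) 1 - (\<lambda>t. \<phi> t \<bullet> u) 0 \<le> r \<bullet> u + e"
  proof (rule mean_value_ineq_AE_real)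
    show "L-lipschitz_on {0..1} (\<lambda>t. \<phi> t \<bullet> u)"
    proof (rule lipschitz_onI)
      fix x y :: real assume "x \<in> {0..1}" "y \<in> {0..1}"
      have "dist (\<phi> x \<bullet> u) (\<phi> y \<bullet> u) \<le> norm (\<phi> x - \<phi> y) * norm u"
        by (simp add: dist_real_def inner_diff_left[symmetric] Cauchy_Schwarz_ineq2)
      also have "\<dots> \<le> dist (\<phi> x) (\<phi> y) * 1"
        unfolding dist_norm using un by (intro mult_left_mono) auto
      also have "\<dots> \<le> L * dist x y"
        using lip \<open>x \<in> {0..1}\<close> \<open>y \<in> {0..1}\<close> by (auto simp: lipschitz_on_def)
      finally show "dist (\<phi> x \<bullet> u) (\<phi> y \<bullet> u) \<le> L * dist x y" .
    qed (use lip lipschitz_on_nonneg in auto)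
    show "AE t in lebesgue_on {0..1}. \<exists>d\<le>r \<bullet> u + e. ((\<lambda>t. \<phi> t \<bullet> u) has_real_derivative d) (at t)"
      using der
    proof eventually_elim
      case (elim t)
      then obtain d where d: "norm (d - r) \<le> e" "(\<phi> has_vector_derivative d) (at t)"
        by blast
      have "((\<lambda>t. \<phi> t \<bullet> u) has_real_derivative (d \<bullet> u)) (at t)"
        using d(2) unfolding has_vector_derivative_def has_field_derivative_def
        by (auto intro!: derivative_eq_intros simp: fun_eq_iff)
      moreover have "(d - r) \<bullet> u \<le> norm (d - r) * norm u"
        by (rule norm_cauchy_schwarz)
      then have "(d - r) \<bullet> u \<le> e"
        using mult_mono[OF d(1) un] d(1) by (smt (verit) norm_ge_zero mult_1_right)
      ultimately show ?case
        by (intro exI[of _ "d \<bullet> u"]) (simp add: inner_diff_left)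
    qed
  qed
  have "norm w = w \<bullet> u"
    by (cases "w = 0") (auto simp: u_def sgn_div_norm dot_square_norm power2_eq_square)
  then show ?thesis
    using * by (simp add: w_def inner_diff_left)
qed

section \<open>Absolutely continuous curves and locally Lipschitz maps\<close>

lemma abs_continuous_curve_lipschitz:
  assumes "abs_continuous_curve c"
    and lip: "\<And>s t. s \<in> {0..1} \<Longrightarrow> t \<in> {0..1} \<Longrightarrow> norm (d s - d t) \<le> L * norm (c s - c t)"
  shows "abs_continuous_curve d"
  unfolding abs_continuous_curve_def
proof (intro allI impI)
  fix \<epsilon> :: real assume "\<epsilon> > 0"
  \<comment> \<open>The sign of \<open>L\<close> is not known; a positive majorant makes
    \<open>\<epsilon> / L'\<close> a legitimate tolerance.\<close>
  define L' where "L' = \<bar>L\<bar> + 1"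
  have "L' > 0" "L \<le> L'" by (auto simp: L'_def)
  then have "\<epsilon> / L' > 0" using \<open>\<epsilon> > 0\<close> by simp
  then obtain \<delta> where \<delta>: "\<delta> > 0" and *: "\<forall>(n::nat) (a::nat \<Rightarrow> real) b.
        (\<forall>i<n. 0 \<le> a i \<and> a i \<le> b i \<and> b i \<le> 1)
        \<and> (\<forall>i<n. \<forall>j<n. i \<noteq> j \<longrightarrow> b i \<le> a j \<or> b j \<le> a i)
        \<and> (\<Sum>i<n. b i - a i) < \<delta>
        \<longrightarrow> (\<Sum>i<n. norm (c (b i) - c (a i))) < \<epsilon> / L'"
    using assms(1)[unfolded abs_continuous_curve_def, THEN spec, THEN mp]
    by - (erule meta_allE, erule (1) meta_impE, erule exE, erule conjE, rule that)
  show "\<exists>\<delta>>0. \<forall>(n::nat) (a::nat \<Rightarrow> real) b.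
        (\<forall>i<n. 0 \<le> a i \<and> a i \<le> b i \<and> b i \<le> 1)
        \<and> (\<forall>i<n. \<forall>j<n. i \<noteq> j \<longrightarrow> b i \<le> a j \<or> b j \<le> a i)
        \<and> (\<Sum>i<n. b i - a i) < \<delta>
        \<longrightarrow> (\<Sum>i<n. norm (d (b i) - d (a i))) < \<epsilon>"
  proof (intro exI[of _ \<delta>] conjI \<delta> allI impI, elim conjE)
    fix n and a b :: "nat \<Rightarrow> real"
    assume 1: "\<forall>i<n. 0 \<le> a i \<and> a i \<le> b i \<and> b i \<le> 1"
      and 2: "\<forall>i<n. \<forall>j<n. i \<noteq> j \<longrightarrow> b i \<le> a j \<or> b j \<le> a i"
      and 3: "(\<Sum>i<n. b i - a i) < \<delta>"
    have "(\<Sum>i<n. norm (d (b i) - d (a i))) \<le> (\<Sum>i<n. L' * norm (c (b i) - c (a i)))"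
    proof (rule sum_mono)
      fix i assume "i \<in> {..<n}"
      then have "0 \<le> a i \<and> a i \<le> b i \<and> b i \<le> 1"
        using 1 by auto
      then have "norm (d (b i) - d (a i)) \<le> L * norm (c (b i) - c (a i))"
        by (intro lip) auto
      also have "\<dots> \<le> L' * norm (c (b i) - c (a i))"
        using \<open>L \<le> L'\<close> by (intro mult_right_mono) auto
      finally show "norm (d (b i) - d (a i)) \<le> L' * norm (c (b i) - c (a i))" .
    qed
    also have "\<dots> = L' * (\<Sum>i<n. norm (c (b i) - c (a i)))"
      by (simp add: sum_distrib_left)
    also have "\<dots> < L' * (\<epsilon> / L')"
      using *[rule_format, of n a b] 1 2 3 \<open>L' > 0\<close> by (intro mult_strict_left_mono) auto
    finally show "(\<Sum>i<n. norm (d (b i) - d (a i))) < \<epsilon>"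
      using \<open>L' > 0\<close> by simp
  qed
qed

lemma abs_continuous_curve_id: "abs_continuous_curve (\<lambda>t::real. t)"
  unfolding abs_continuous_curve_def
proof (intro allI impI)
  fix \<epsilon> :: real assume "\<epsilon> > 0"
  have "(\<Sum>i<n. norm (b i - a i)) = (\<Sum>i<n. b i - a i)"
    if "\<forall>i<n. 0 \<le> a i \<and> a i \<le> b i \<and> b i \<le> 1" for n and a b :: "nat \<Rightarrow> real"
    using that by (intro sum.cong) auto
  then show "\<exists>\<delta>>0. \<forall>(n::nat) (a::nat \<Rightarrow> real) b.
        (\<forall>i<n. 0 \<le> a i \<and> a i \<le> b i \<and> b i \<le> 1)
        \<and> (\<forall>i<n. \<forall>j<n. i \<noteq> j \<longrightarrow> b i \<le> a j \<or> b j \<le> a i)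
        \<and> (\<Sum>i<n. b i - a i) < \<delta>
        \<longrightarrow> (\<Sum>i<n. norm (b i - a i)) < \<epsilon>"
    using \<open>\<epsilon> > 0\<close> by (intro exI[of _ \<epsilon>]) auto
qed

lemma abs_continuous_curve_line: "abs_continuous_curve (\<lambda>t. y + t *\<^sub>R h)"
  by (rule abs_continuous_curve_lipschitz[OF abs_continuous_curve_id, where L = "norm h"])
     (simp add: scaleR_diff_left[symmetric])

lemma abs_continuous_curve_continuous_on:
  assumes "abs_continuous_curve c"
  shows "continuous_on {0..1} c"
  unfolding continuous_on_iff
proof (intro ballI allI impI)
  fix x \<epsilon> :: real assume x: "x \<in> {0..1}" and "\<epsilon> > 0"
  then obtain \<delta> where \<delta>: "\<delta> > 0" and *: "\<forall>(n::nat) (a::nat \<Rightarrow> real) b.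
        (\<forall>i<n. 0 \<le> a i \<and> a i \<le> b i \<and> b i \<le> 1)
        \<and> (\<forall>i<n. \<forall>j<n. i \<noteq> j \<longrightarrow> b i \<le> a j \<or> b j \<le> a i)
        \<and> (\<Sum>i<n. b i - a i) < \<delta>
        \<longrightarrow> (\<Sum>i<n. norm (c (b i) - c (a i))) < \<epsilon>"
    using assms(1)[unfolded abs_continuous_curve_def, THEN spec, THEN mp]
    by - (erule meta_allE, erule (1) meta_impE, erule exE, erule conjE, rule that)
  \<comment> \<open>Absolute continuity is applied to a family of one interval, the one between
    \<open>x\<close> and \<open>y\<close>.\<close>
  have "dist (c y) (c x) < \<epsilon>" if "y \<in> {0..1}" "dist y x < \<delta>" for y
    using *[rule_format, of 1 "\<lambda>_. min x y" "\<lambda>_. max x y"] that x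
    by (cases "x \<le> y") (auto simp: dist_norm norm_minus_commute)
  then show "\<exists>d>0. \<forall>x'\<in>{0..1}. dist x' x < d \<longrightarrow> dist (c x') (c x) < \<epsilon>"
    using \<delta> by blast
qed

text \<open>Viewing \<open>F\<close> as a time-dependent map with the single time 0 makes the
  compactness result for \<open>local_lipschitz\<close> applicable, which merges the local constants
  into one.\<close>

lemma loc_lipschitz_on_compact_subset:
  assumes "loc_lipschitz_on D F" "compact C" "C \<subseteq> D"
  obtains L where "L-lipschitz_on C F"
proof -
  have "local_lipschitz {0::real} C (\<lambda>_. F)"
    unfolding local_lipschitz_def
  proof (intro ballI)
    fix x assume "x \<in> C"
    then obtain e L where e: "e > 0" "L-lipschitz_on (ball x e \<inter> D) F"
      using assms unfolding loc_lipschitz_on_def by blast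
    have "L-lipschitz_on (cball x (e/2) \<inter> C) F"
      by (rule lipschitz_on_subset[OF e(2)]) (use e(1) assms(3) in auto)
    then show "\<exists>u>0. \<exists>L. \<forall>t\<in>cball t u \<inter> {0::real}. L-lipschitz_on (cball x u \<inter> C) F" for t
      using e(1) by (intro exI[of _ "e/2"]) auto
  qed
  then obtain L where "\<And>t. t \<in> {0::real} \<Longrightarrow> L-lipschitz_on C F"
    using local_lipschitz_compact_implies_lipschitz[OF _ \<open>compact C\<close>] by (metis compact_sing continuous_on_sing)
  then show ?thesis
    using that by auto
qed

lemma loc_lipschitz_on_continuous_on:
  assumes "loc_lipschitz_on D F" "open D"
  shows "continuous_on D F"
  unfolding continuous_on_eq_continuous_at[OF assms(2)]
proof
  fix x assume "x \<in> D"
  then obtain e L where e: "e > 0" "L-lipschitz_on (ball x e \<inter> D) F"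
    using assms unfolding loc_lipschitz_on_def by blast
  then have "continuous_on (ball x e \<inter> D) F"
    using lipschitz_on_continuous_on by blast
  then show "isCont F x"
    using e(1) \<open>x \<in> D\<close> assms(2)
    by (subst (asm) continuous_on_eq_continuous_at) auto
qed

lemma abs_continuous_curve_loc_lipschitz:
  assumes "loc_lipschitz_on D F" "abs_continuous_curve c" "c ` {0..1} \<subseteq> D"
  shows "abs_continuous_curve (F \<circ> c)"
proof -
  have "compact (c ` {0..1})"
    using abs_continuous_curve_continuous_on[OF assms(2)] by (intro compact_continuous_image) auto
  then obtain L where "L-lipschitz_on (c ` {0..1}) F"
    using loc_lipschitz_on_compact_subset assms by metis
  then show ?thesis
    using assms(2)
    by (intro abs_continuous_curve_lipschitz[of c "F \<circ> c" L]) (auto simp: lipschitz_on_def dist_norm)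
qed

text \<open>On the segment the velocity is \<open>h\<close>, so at almost every time the derivative
  of \<open>F\<close> is \<open>M *v h\<close> for a value \<open>M\<close> of \<open>J\<close> at a
  point of \<open>U\<close>, hence within \<open>e\<close> of \<open>r\<close>. Convexity of
  \<open>U\<close> keeps the segment inside.\<close>

lemma conservative_jac_mean_value:
  fixes F :: "real^'a \<Rightarrow> real^'b"
  assumes J: "conservative_jac_on D F J"
    and U: "convex U" "U \<subseteq> D" "L-lipschitz_on U F" "y \<in> U" "y + h \<in> U"
    and bd: "\<And>w M. w \<in> U \<Longrightarrow> M \<in> J w \<Longrightarrow> norm (M *v h - r) \<le> e"
  shows "norm (F (y + h) - F y - r) \<le> e"
proof -
  define c where "c = (\<lambda>t. y + t *\<^sub>R h)"
  have cU: "c t \<in> U" if "t \<in> {0..1}" for t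
  proof -
    have "c t = (1 - t) *\<^sub>R y + t *\<^sub>R (y + h)"
      by (simp add: c_def algebra_simps)
    then show ?thesis
      using that U(1,4,5) by (simp add: convexD)
  qed
  have der: "(c has_vector_derivative h) (at t)" for t
    unfolding c_def by (auto intro!: derivative_eq_intros)
  have "AE t in lebesgue_on {0..1}. \<exists>c'. (c has_vector_derivative c') (at t)
               \<and> (\<forall>M\<in>J (c t). ((F \<circ> c) has_vector_derivative (M *v c')) (at t))"
  proof -
    have "abs_continuous_curve c" "c ` {0..1} \<subseteq> D"
      using cU U(2) abs_continuous_curve_line by (auto simp: c_def)
    then show ?thesis
      using J unfolding conservative_jac_on_def by blast
  qed
  moreover have "AE t in lebesgue_on {0..1}. t \<in> {0..1}"
    using AE_space[of "lebesgue_on {0..1}"] by simp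
  ultimately have "AE t in lebesgue_on {0..1}. \<exists>d. norm (d - r) \<le> e \<and> ((F \<circ> c) has_vector_derivative d) (at t)"
  proof eventually_elim
    case (elim t)
    then obtain c' where c': "(c has_vector_derivative c') (at t)"
      "\<forall>M\<in>J (c t). ((F \<circ> c) has_vector_derivative (M *v c')) (at t)" by blast
    have "c' = h"
      using c'(1) der vector_derivative_unique_at by blast
    moreover obtain M where "M \<in> J (c t)"
      using J cU[OF elim(2)] U(2) unfolding conservative_jac_on_def by blast
    ultimately show ?case
      using c'(2) bd[OF cU[OF elim(2)]] by blast
  qed
  moreover have "(L * norm h)-lipschitz_on {0..1} (F \<circ> c)"
  proof (rule lipschitz_onI)
    fix s t :: real assume st: "s \<in> {0..1}" "t \<in> {0..1}"
    have "dist ((F \<circ> c) s) ((F \<circ> c) t) \<le> L * dist (c s) (c t)"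
      using U(3) cU st by (auto simp: lipschitz_on_def)
    also have "dist (c s) (c t) = norm h * dist s t"
      by (simp add: c_def dist_norm scaleR_diff_left[symmetric])
    finally show "dist ((F \<circ> c) s) ((F \<circ> c) t) \<le> L * norm h * dist s t"
      by (simp add: mult.assoc)
  qed (use lipschitz_on_nonneg[OF U(3)] in auto)
  ultimately have "norm ((F \<circ> c) 1 - (F \<circ> c) 0 - r) \<le> e"
    using mean_value_ineq_AE by blast
  then show ?thesis
    by (simp add: c_def)
qed

section \<open>Locally bounded set-valued maps with closed graph\<close>

text \<open>These two clauses of \<open>conservative_jac_on\<close> say that the map is upper
  semicontinuous with compact values ("usco"), except that empty values are allowed.\<close>

definition usco_on :: "'a::metric_space set \<Rightarrow> ('a \<Rightarrow> 'b::euclidean_space set) \<Rightarrow> bool" where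
  "usco_on D J \<longleftrightarrow>
     (\<forall>z\<in>D. \<exists>e>0. bounded (\<Union>w\<in>ball z e \<inter> D. J w))
     \<and> closedin (top_of_set (D \<times> UNIV)) {(z, M). z \<in> D \<and> M \<in> J z}"

lemma closedin_iff_sequentially_closed:
  fixes S :: "'a::first_countable_topology set"
  shows "closedin (top_of_set S) T \<longleftrightarrow>
    T \<subseteq> S \<and> (\<forall>x l. (\<forall>n. x n \<in> T) \<and> l \<in> S \<and> x \<longlonglongrightarrow> l \<longrightarrow> l \<in> T)"
proof
  assume "closedin (top_of_set S) T"
  then obtain C where "closed C" "T = S \<inter> C"
    by (auto simp: closedin_closed)
  then show "T \<subseteq> S \<and> (\<forall>x l. (\<forall>n. x n \<in> T) \<and> l \<in> S \<and> x \<longlonglongrightarrow> l \<longrightarrow> l \<in> T)"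
    using closed_sequentially[of C] by auto
next
  assume "T \<subseteq> S \<and> (\<forall>x l. (\<forall>n. x n \<in> T) \<and> l \<in> S \<and> x \<longlonglongrightarrow> l \<longrightarrow> l \<in> T)"
  then have "T = S \<inter> closure T"
    using closure_subset[of T] by (auto simp: closure_sequential)
  then show "closedin (top_of_set S) T"
    using closedin_closed closed_closure by blast
qed

lemma usco_on_closed:
  assumes "usco_on D J" "z \<in> D" "\<And>n. ws n \<in> D" "ws \<longlonglongrightarrow> z" "\<And>n. Ms n \<in> J (ws n)" "Ms \<longlonglongrightarrow> M"
  shows "M \<in> J z"
proof -
  have "closedin (top_of_set (D \<times> UNIV)) {(z, M). z \<in> D \<and> M \<in> J z}"
    using assms(1) by (simp add: usco_on_def)
  moreover have "(\<lambda>n. (ws n, Ms n)) \<longlonglongrightarrow> (z, M)"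
    using assms by (intro tendsto_Pair)
  ultimately have "(z, M) \<in> {(z, M). z \<in> D \<and> M \<in> J z}"
    unfolding closedin_iff_sequentially_closed using assms(2,3,5) by (metis (mono_tags, lifting) SigmaI UNIV_I case_prodI mem_Collect_eq)
  then show ?thesis by simp
qed

lemma usco_on_subseq:
  assumes "usco_on D J" "z \<in> D" "\<And>n. ws n \<in> D" "ws \<longlonglongrightarrow> z" "\<And>n. Ms n \<in> J (ws n)"
  obtains r M where "strict_mono (r :: nat \<Rightarrow> nat)" "M \<in> J z" "(Ms \<circ> r) \<longlonglongrightarrow> M"
proof -
  obtain e where e: "e > 0" "bounded (\<Union>w\<in>ball z e \<inter> D. J w)"
    using assms(1,2) unfolding usco_on_def by blast
  have "\<forall>\<^sub>F n in sequentially. dist (ws n) z < e"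
    using assms(4) e(1) by (simp add: tendsto_iff)
  then obtain N where N: "\<And>n. n \<ge> N \<Longrightarrow> dist (ws n) z < e"
    unfolding eventually_sequentially by blast
  have "range (\<lambda>n. Ms (n + N)) \<subseteq> (\<Union>w\<in>ball z e \<inter> D. J w)"
    using N assms(3,5) by (force simp: dist_commute)
  then have "bounded (range (\<lambda>n. Ms (n + N)))"
    using e(2) bounded_subset by blast
  then obtain M r where r: "strict_mono r" "((\<lambda>n. Ms (n + N)) \<circ> r) \<longlonglongrightarrow> M"
    using bounded_imp_convergent_subsequence by blast
  define r' where "r' = (\<lambda>n. r n + N)"
  have r': "strict_mono r'" "(Ms \<circ> r') \<longlonglongrightarrow> M"
    using r by (auto simp: r'_def strict_mono_def o_def)
  have "(ws \<circ> r') \<longlonglongrightarrow> z"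
    using assms(4) r'(1) by (rule LIMSEQ_subseq_LIMSEQ)
  then have "M \<in> J z"
    using usco_on_closed[OF assms(1,2), of "ws \<circ> r'" "Ms \<circ> r'" M] r'(2) assms(3,5) by auto
  then show ?thesis
    using that r' by blast
qed

text \<open>Converse of \<open>usco_on_subseq\<close>, giving a purely sequential criterion. If
  boundedness failed near \<open>z\<close>, values of norm above \<open>n\<close> at points within
  \<open>1/(n+1)\<close> of \<open>z\<close> would form a sequence without convergent
  subsequence.\<close>

lemma usco_onI:
  assumes "\<And>z ws Ms. z \<in> D \<Longrightarrow> (\<And>n. ws n \<in> D) \<Longrightarrow> ws \<longlonglongrightarrow> z \<Longrightarrow> (\<And>n. Ms n \<in> J (ws n))
    \<Longrightarrow> \<exists>r M. strict_mono (r :: nat \<Rightarrow> nat) \<and> M \<in> J z \<and> (Ms \<circ> r) \<longlonglongrightarrow> M"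
  shows "usco_on D J"
  unfolding usco_on_def
proof (intro conjI ballI)
  fix z assume z: "z \<in> D"
  show "\<exists>e>0. bounded (\<Union>w\<in>ball z e \<inter> D. J w)"
  proof (rule ccontr)
    assume *: "\<not> (\<exists>e>0. bounded (\<Union>w\<in>ball z e \<inter> D. J w))"
    have "\<exists>w M. w \<in> ball z (inverse (real (Suc n))) \<inter> D \<and> M \<in> J w \<and> norm M > real n" for n
    proof -
      have "\<not> bounded (\<Union>w\<in>ball z (inverse (real (Suc n))) \<inter> D. J w)"
        using * by (metis inverse_positive_iff_positive of_nat_0_less_iff zero_less_Suc)
      then show ?thesis
        unfolding bounded_iff by (metis UN_E not_le)
    qed
    then obtain ws Ms where ws: "\<And>n. ws n \<in> ball z (inverse (real (Suc n)))" "\<And>n. ws n \<in> D"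
      and Ms: "\<And>n. Ms n \<in> J (ws n)" "\<And>n. norm (Ms n) > real n"
      by (metis IntD1 IntD2)
    have "(\<lambda>n. dist (ws n) z) \<longlonglongrightarrow> 0"
      by (rule tendsto_sandwich[OF _ _ tendsto_const LIMSEQ_inverse_real_of_nat])
         (use ws(1) in \<open>auto simp: dist_commute intro!: always_eventually less_imp_le\<close>)
    then have "ws \<longlonglongrightarrow> z"
      using tendsto_dist_iff by blast
    then obtain r M where r: "strict_mono r" "(Ms \<circ> r) \<longlonglongrightarrow> M"
      using assms[of z ws Ms] z ws(2) Ms(1) by blast
    have "Bseq (Ms \<circ> r)"
      using r(2) convergent_imp_Bseq convergentI by blast
    then obtain B where "\<And>n. norm (Ms (r n)) \<le> B"
      unfolding Bseq_def by auto
    moreover obtain n where "real n > B"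
      using reals_Archimedean2 by blast
    moreover have "real n \<le> real (r n)"
      using r(1) seq_suble by auto
    ultimately show False
      using Ms(2)[of "r n"] by (smt (verit))
  qed
next
  show "closedin (top_of_set (D \<times> UNIV)) {(z, M). z \<in> D \<and> M \<in> J z}"
    unfolding closedin_iff_sequentially_closed
  proof (intro conjI allI impI, goal_cases)
    case (2 x l)
    then have x: "\<And>n. fst (x n) \<in> D" "\<And>n. snd (x n) \<in> J (fst (x n))" and l: "fst l \<in> D"
      and lim: "x \<longlonglongrightarrow> l"
      by (auto simp: case_prod_beta)
    obtain r M where r: "strict_mono r" "M \<in> J (fst l)" "((\<lambda>n. snd (x n)) \<circ> r) \<longlonglongrightarrow> M"
      using assms[OF l x(1) tendsto_fst[OF lim] x(2)] by blast
    have "((\<lambda>n. snd (x n)) \<circ> r) \<longlonglongrightarrow> snd l"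
      using tendsto_snd[OF lim] r(1) by (rule LIMSEQ_subseq_LIMSEQ)
    then have "M = snd l"
      using r(3) LIMSEQ_unique by blast
    then show ?case
      using r l by (auto simp: case_prod_beta)
  qed auto
qed

lemma usco_on_compact:
  assumes "usco_on D J" "z \<in> D"
  shows "compact (J z)"
  unfolding compact_def
proof (intro allI impI)
  fix f :: "nat \<Rightarrow> 'b" assume "\<forall>n. f n \<in> J z"
  then show "\<exists>l\<in>J z. \<exists>r. strict_mono r \<and> (f \<circ> r) \<longlonglongrightarrow> l"
    using usco_on_subseq[OF assms, of "\<lambda>_. z" f] assms(2) by (metis tendsto_const)
qed

text \<open>Upper semicontinuity in its topological form: values outside \<open>V\<close> at points
  tending to \<open>z\<close> would accumulate at an element of \<open>J z\<close> in the closed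
  complement of \<open>V\<close>.\<close>

lemma usco_on_nbhd:
  assumes "usco_on D J" "z \<in> D" "open V" "J z \<subseteq> V"
  obtains d where "d > 0" "\<And>w. w \<in> D \<Longrightarrow> dist w z < d \<Longrightarrow> J w \<subseteq> V"
proof (rule ccontr)
  assume "\<not> thesis"
  then have *: "\<exists>w\<in>D. dist w z < d \<and> \<not> J w \<subseteq> V" if "d > 0" for d
    using that \<open>\<And>d. 0 < d \<Longrightarrow> (\<And>w. w \<in> D \<Longrightarrow> dist w z < d \<Longrightarrow> J w \<subseteq> V) \<Longrightarrow> thesis\<close> by blast
  have "\<exists>w M. w \<in> D \<and> dist w z < inverse (real (Suc n)) \<and> M \<in> J w \<and> M \<notin> V" for n
    using *[of "inverse (real (Suc n))"] by auto
  then obtain ws Ms where ws: "\<And>n. ws n \<in> D" "\<And>n. dist (ws n) z < inverse (real (Suc n))"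
    and Ms: "\<And>n. Ms n \<in> J (ws n)" "\<And>n. Ms n \<notin> V"
    by metis
  have "(\<lambda>n. dist (ws n) z) \<longlonglongrightarrow> 0"
    by (rule tendsto_sandwich[OF _ _ tendsto_const LIMSEQ_inverse_real_of_nat])
       (use ws(2) in \<open>auto intro!: always_eventually less_imp_le\<close>)
  then have "ws \<longlonglongrightarrow> z"
    using tendsto_dist_iff by blast
  then obtain r M where r: "strict_mono r" "M \<in> J z" "(Ms \<circ> r) \<longlonglongrightarrow> M"
    using usco_on_subseq[OF assms(1,2), of ws Ms] ws(1) Ms(1) by blast
  have "closed (- V)"
    using assms(3) by blast
  then have "M \<in> - V"
    by (rule closed_sequentially[OF _ _ r(3)]) (use Ms(2) in auto)
  then show False
    using r(2) assms(4) by auto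
qed

text \<open>The open \<open>e\<close>-neighbourhood of a convex set is its Minkowski sum with a
  ball, hence convex, so it contains the hull of whatever it contains.\<close>

lemma convex_hull_subset_ball_sum:
  fixes A B :: "'a::euclidean_space set"
  assumes "A \<subseteq> (\<Union>x\<in>B. ball x e)"
  shows "convex hull A \<subseteq> (\<Union>x\<in>convex hull B. ball x e)"
proof -
  have eq: "(\<Union>x\<in>convex hull B. ball x e) = (\<Union>x\<in>convex hull B. \<Union>y\<in>ball 0 e. {x + y})"
  proof -
    have "w = x + (w - x) \<and> w - x \<in> ball 0 e" if "w \<in> ball x e" for w x :: 'a
      using that by (simp add: dist_norm norm_minus_commute[of x w])
    then show ?thesis
      by (fastforce simp: dist_norm)
  qed
  have "convex (\<Union>x\<in>convex hull B. ball x e)"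
    unfolding eq by (intro convex_sums convex_convex_hull convex_ball)
  moreover have "A \<subseteq> (\<Union>x\<in>convex hull B. ball x e)"
    using assms hull_subset[of B convex] by blast
  ultimately show ?thesis
    by (simp add: hull_minimal)
qed

text \<open>The hull of \<open>J w\<close> stays in any prescribed neighbourhood of the compact hull
  of \<open>J z\<close> for \<open>w\<close> near \<open>z\<close>. Nearest points
  \<open>As n\<close> in that compact set then have a convergent subsequence, and
  \<open>Ms n\<close> is asymptotically equal to \<open>As n\<close>.\<close>

lemma usco_on_convex_hull:
  assumes "usco_on D J"
  shows "usco_on D (\<lambda>z. convex hull (J z))"
proof (rule usco_onI)
  fix z ws Ms
  assume z: "z \<in> D" and ws: "\<And>n. ws n \<in> D" "ws \<longlonglongrightarrow> z" and Ms: "\<And>n. Ms n \<in> convex hull (J (ws n))"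
  have comp: "compact (convex hull (J z))"
    using usco_on_compact[OF assms z] by (rule compact_convex_hull)
  have near: "\<forall>\<^sub>F n in sequentially. \<exists>A\<in>convex hull (J z). dist A (Ms n) < e" if "e > 0" for e
  proof -
    have "open (\<Union>A\<in>J z. ball A e)" "J z \<subseteq> (\<Union>A\<in>J z. ball A e)"
      using that by auto
    then obtain d where d: "d > 0" "\<And>w. w \<in> D \<Longrightarrow> dist w z < d \<Longrightarrow> J w \<subseteq> (\<Union>A\<in>J z. ball A e)"
      using usco_on_nbhd[OF assms z] by metis
    have "\<forall>\<^sub>F n in sequentially. dist (ws n) z < d"
      using ws(2) d(1) by (simp add: tendsto_iff)
    then show ?thesis
    proof eventually_elim
      case (elim n)
      then have "Ms n \<in> (\<Union>A\<in>convex hull (J z). ball A e)"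
        using convex_hull_subset_ball_sum[OF d(2)[OF ws(1)]] Ms by blast
      then show ?case by auto
    qed
  qed
  define m where "m n = infdist (Ms n) (convex hull (J z))" for n
  \<comment> \<open>Empty values are not excluded by \<open>usco_on\<close>; nonemptiness at
    \<open>z\<close> is read off from \<open>near\<close>, since a sequence \<open>Ms\<close> is
    given.\<close>
  have ne: "convex hull (J z) \<noteq> {}"
    using near[of 1] eventually_happens by force
  have "\<exists>A\<in>convex hull (J z). infdist (Ms n) (convex hull (J z)) = dist (Ms n) A" for n
    using infdist_attains_inf[OF compact_imp_closed[OF comp] ne] by blast
  then obtain As where As: "\<And>n. As n \<in> convex hull (J z)" "\<And>n. m n = dist (Ms n) (As n)"
    unfolding m_def by metis
  have "m \<longlonglongrightarrow> 0"
    unfolding tendsto_iff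
  proof (intro allI impI)
    fix e :: real assume "e > 0"
    show "\<forall>\<^sub>F n in sequentially. dist (m n) 0 < e"
      using near[OF \<open>e > 0\<close>]
    proof eventually_elim
      case (elim n)
      then show ?case
        unfolding m_def using infdist_le[of _ "convex hull (J z)" "Ms n"]
        by (smt (verit) dist_commute dist_real_def infdist_nonneg)
    qed
  qed
  obtain M r where r: "M \<in> convex hull (J z)" "strict_mono r" "(As \<circ> r) \<longlonglongrightarrow> M"
    using comp As(1) unfolding compact_def by blast
  have "(\<lambda>n. dist ((Ms \<circ> r) n) ((As \<circ> r) n)) \<longlonglongrightarrow> 0"
    using LIMSEQ_subseq_LIMSEQ[OF \<open>m \<longlonglongrightarrow> 0\<close> r(2)] As(2) by (simp add: o_def)
  then have "(Ms \<circ> r) \<longlonglongrightarrow> M"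
    by (intro Lim_transform[OF r(3)]) (simp add: dist_norm tendsto_norm_zero_iff)
  then show "\<exists>r M. strict_mono (r::nat \<Rightarrow> nat) \<and> M \<in> convex hull (J z) \<and> (Ms \<circ> r) \<longlonglongrightarrow> M"
    using r by blast
qed

section \<open>The Clarke Jacobian of a path differentiable map is conservative\<close>

lemma conservative_jac_on_iff:
  "conservative_jac_on D F J \<longleftrightarrow>
     (\<forall>z\<in>D. J z \<noteq> {}) \<and> usco_on D J
     \<and> (\<forall>c. abs_continuous_curve c \<and> c ` {0..1} \<subseteq> D \<longrightarrow>
          (AE t in lebesgue_on {0..1}.
             \<exists>c'. (c has_vector_derivative c') (at t)
               \<and> (\<forall>M\<in>J (c t). ((F \<circ> c) has_vector_derivative (M *v c')) (at t))))"
  unfolding conservative_jac_on_def usco_on_def by blast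

lemma AE_lebesgue_on_unit_interval_ex:
  assumes "AE t in lebesgue_on {0..1::real}. P t"
  shows "\<exists>t\<in>{0..1}. P t"
proof (rule ccontr)
  assume *: "\<not> ?thesis"
  have "AE t in lebesgue. t \<in> {0..1} \<longrightarrow> P t"
    using assms by (subst (asm) AE_restrict_space_iff) auto
  then have "{t. \<not> (t \<in> {0..1} \<longrightarrow> P t)} \<in> null_sets lebesgue"
    by (simp add: completion.AE_iff_null_sets)
  moreover have "{t. \<not> (t \<in> {0..1} \<longrightarrow> P t)} = {0..1}"
    using * by auto
  ultimately have "negligible {0..1::real}"
    by (simp add: negligible_iff_null_sets)
  then have "negligible {0<..<1::real}"
    by (rule negligible_subset) auto
  then show False
    using open_not_negligible[of "{0<..<1::real}"] by auto
qed

text \<open>At a time where the chain rule holds, every \<open>M *v h\<close> is the derivative of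
  the same curve, and derivatives are unique.\<close>

lemma conservative_jac_unique_on_line:
  fixes F :: "real^'a \<Rightarrow> real^'b"
  assumes J: "conservative_jac_on D F J" and seg: "\<And>t. t \<in> {0..1} \<Longrightarrow> y + t *\<^sub>R h \<in> D"
  obtains t where "t \<in> {0..1}" "\<And>M M'. M \<in> J (y + t *\<^sub>R h) \<Longrightarrow> M' \<in> J (y + t *\<^sub>R h) \<Longrightarrow> M *v h = M' *v h"
proof -
  define c where "c = (\<lambda>t. y + t *\<^sub>R h)"
  have "AE t in lebesgue_on {0..1}. \<exists>c'. (c has_vector_derivative c') (at t)
               \<and> (\<forall>M\<in>J (c t). ((F \<circ> c) has_vector_derivative (M *v c')) (at t))"
  proof -
    have "abs_continuous_curve c" "c ` {0..1} \<subseteq> D"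
      using seg abs_continuous_curve_line by (auto simp: c_def)
    then show ?thesis
      using J unfolding conservative_jac_on_def by blast
  qed
  then obtain t c' where t: "t \<in> {0..1}" "(c has_vector_derivative c') (at t)"
    "\<forall>M\<in>J (c t). ((F \<circ> c) has_vector_derivative (M *v c')) (at t)"
    using AE_lebesgue_on_unit_interval_ex by blast
  have "(c has_vector_derivative h) (at t)"
    unfolding c_def by (auto intro!: derivative_eq_intros)
  then have "c' = h"
    using t(2) vector_derivative_unique_at by blast
  then show ?thesis
    using that[OF t(1)] t(3) vector_derivative_unique_at unfolding c_def by blast
qed

text \<open>The set where the values \<open>M *v h\<close>, \<open>M \<in> J w\<close>, spread by at least a fixed amount is closed, and it
  contains no segment parallel to \<open>h\<close>. By Baire's theorem \<open>J\<close> is single-valued on a dense set, which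
  replaces Rademacher's theorem.\<close>

lemma conservative_jac_singleton_dense:
  fixes F :: "real^'a \<Rightarrow> real^'b"
  assumes J: "conservative_jac_on D F J" and "open D" "z \<in> D" "e > 0"
  obtains w M where "w \<in> D" "dist w z < e" "J w = {M}"
proof -
  have us: "usco_on D J"
    using J by (simp add: conservative_jac_on_iff)
  obtain r where r: "r > 0" "cball z r \<subseteq> D" "r < e"
  proof -
    obtain r0 where "r0 > 0" "cball z r0 \<subseteq> D"
      using \<open>open D\<close> \<open>z \<in> D\<close> open_contains_cball by blast
    then show ?thesis
      using that[of "min r0 (e/2)"] \<open>e > 0\<close> by (auto simp: subset_iff)
  qed
  define S where "S = cball z r"
  \<comment> \<open>Columns \<open>j\<close> and tolerances \<open>1/(k+1)\<close> give a countable
    family; at a point of all \<open>G (j, k)\<close> any two elements of \<open>J w\<close> have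
    equal columns. The ambient \<open>S\<close> is a closed ball because Baire's theorem is applied
    in that subspace.\<close>
  define G where "G = (\<lambda>(j::'a, k::nat). {w \<in> S. \<forall>M\<in>J w. \<forall>M'\<in>J w.
      norm (M *v axis j 1 - M' *v axis j 1) < inverse (Suc k)})"
  have ope: "openin (top_of_set S) (G (j, k)) \<and> S \<subseteq> closure (G (j, k))" for j k
  proof
    have "closedin (top_of_set S) (S - G (j, k))"
      unfolding closedin_iff_sequentially_closed
    proof (intro conjI allI impI)
      fix x l assume *: "(\<forall>n. x n \<in> S - G (j, k)) \<and> l \<in> S \<and> x \<longlonglongrightarrow> l"
      have "\<exists>M M'. M \<in> J (x n) \<and> M' \<in> J (x n) \<and>
          norm (M *v axis j 1 - M' *v axis j 1) \<ge> inverse (Suc k)" for n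
      proof -
        have "x n \<in> S - G (j, k)" using * by blast
        then show ?thesis
          unfolding G_def by (auto simp: not_less simp del: of_nat_Suc)
      qed
      then obtain M M' where M: "\<And>n. M n \<in> J (x n)" "\<And>n. M' n \<in> J (x n)"
        "\<And>n. norm (M n *v axis j 1 - M' n *v axis j 1) \<ge> inverse (Suc k)"
        by metis
      have xD: "\<And>n. x n \<in> D" "l \<in> D" "x \<longlonglongrightarrow> l"
        using * r(2) by (auto simp: S_def)
      obtain p A where p: "strict_mono p" "A \<in> J l" "(M \<circ> p) \<longlonglongrightarrow> A"
        using usco_on_subseq[OF us xD(2,1,3) M(1)] by blast
      obtain q A' where q: "strict_mono q" "A' \<in> J l" "((M' \<circ> p) \<circ> q) \<longlonglongrightarrow> A'"
        using usco_on_subseq[OF us xD(2), of "x \<circ> p" "M' \<circ> p"] xD M(2)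
          LIMSEQ_subseq_LIMSEQ[OF xD(3) p(1)] by auto
      have "((M \<circ> p) \<circ> q) \<longlonglongrightarrow> A"
        using p(3) q(1) by (rule LIMSEQ_subseq_LIMSEQ)
      then have "(\<lambda>n. norm (((M \<circ> p) \<circ> q) n *v axis j 1 - ((M' \<circ> p) \<circ> q) n *v axis j 1))
          \<longlonglongrightarrow> norm (A *v axis j 1 - A' *v axis j 1)"
        using q(3) by (intro tendsto_intros)
      then have "inverse (Suc k) \<le> norm (A *v axis j 1 - A' *v axis j 1)"
        by (rule LIMSEQ_le_const) (use M(3) in auto)
      then show "l \<in> S - G (j, k)"
        using p(2) q(2) * unfolding G_def by (force simp: not_less)
    qed auto
    then have "openin (top_of_set S) (S - (S - G (j, k)))"
      by (metis openin_diff openin_subtopology_self)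
    moreover have "S - (S - G (j, k)) = G (j, k)"
      by (auto simp: G_def)
    ultimately show "openin (top_of_set S) (G (j, k))"
      by simp
    \<comment> \<open>Density is shown on the open ball, where short segments parallel to axis
      \<open>j\<close> stay in \<open>S\<close>; taking closures extends it to
      \<open>S\<close>.\<close>
    have "ball z r \<subseteq> closure (G (j, k))"
    proof
      fix w assume w: "w \<in> ball z r"
      show "w \<in> closure (G (j, k))"
        unfolding closure_approachable
      proof (intro allI impI)
        fix d :: real assume "d > 0"
        obtain d' where d': "d' > 0" "ball w d' \<subseteq> ball z r"
          using w open_contains_ball open_ball by metis
        define s where "s = min d d' / 2"
        have s: "s > 0" "s < d" "s < d'"
          using \<open>d > 0\<close> \<open>d' > 0\<close> by (auto simp: s_def min_def)
        have near: "dist (w + t *\<^sub>R (s *\<^sub>R axis j 1)) w \<le> s" if "t \<in> {0..1}" for t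
          using that s by (simp add: dist_norm mult_left_le_one_le)
        have inS: "w + t *\<^sub>R (s *\<^sub>R axis j 1) \<in> S" if "t \<in> {0..1}" for t
        proof -
          have "w + t *\<^sub>R (s *\<^sub>R axis j 1) \<in> ball w d'"
            using near[OF that] s by (simp add: dist_commute)
          then show ?thesis
            using d'(2) ball_subset_cball unfolding S_def by blast
        qed
        then have inD: "w + t *\<^sub>R (s *\<^sub>R axis j 1) \<in> D" if "t \<in> {0..1}" for t
          using that r(2) unfolding S_def by blast
        obtain t where t: "t \<in> {0..1}" "\<And>M M'. M \<in> J (w + t *\<^sub>R (s *\<^sub>R axis j 1)) \<Longrightarrow>
             M' \<in> J (w + t *\<^sub>R (s *\<^sub>R axis j 1)) \<Longrightarrow> M *v (s *\<^sub>R axis j 1) = M' *v (s *\<^sub>R axis j 1)"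
          using conservative_jac_unique_on_line[OF J inD] by blast
        define q where "q = w + t *\<^sub>R (s *\<^sub>R axis j 1)"
        have "norm (M *v axis j 1 - M' *v axis j 1) < inverse (Suc k)" if "M \<in> J q" "M' \<in> J q" for M M'
        proof -
          have "s *\<^sub>R (M *v axis j 1) = s *\<^sub>R (M' *v axis j 1)"
            using t(2)[of M M'] that unfolding q_def matrix_vector_mult_scaleR .
          then show ?thesis
            using s(1) by simp
        qed
        moreover have "q \<in> S"
          using inS[OF t(1)] by (simp only: q_def)
        ultimately have "q \<in> G (j, k)"
          unfolding G_def by blast
        moreover have "dist q w < d"
          using near[OF t(1)] s(2) by (simp only: q_def)
        ultimately show "\<exists>y\<in>G (j, k). dist y w < d"
          by blast
      qed
    qed
    then have "closure (ball z r) \<subseteq> closure (G (j, k))"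
      by (simp add: closure_minimal)
    then show "S \<subseteq> closure (G (j, k))"
      using r(1) by (simp add: S_def)
  qed
  have "S \<subseteq> closure (\<Inter>(range G))"
    by (rule Baire) (use ope in \<open>auto simp: S_def\<close>)
  then have "\<Inter>(range G) \<noteq> {}"
    using r(1) by (auto simp: S_def)
  then obtain w where w: "\<And>j k. w \<in> G (j, k)"
    by auto
  have wS: "w \<in> S"
    using w by (auto simp: G_def)
  have eq: "M = M'" if "M \<in> J w" "M' \<in> J w" for M M'
  proof -
    have "M *v axis j 1 = M' *v axis j 1" for j
    proof (rule ccontr)
      assume "M *v axis j 1 \<noteq> M' *v axis j 1"
      then have "norm (M *v axis j 1 - M' *v axis j 1) > 0" by simp
      then obtain k where "inverse (Suc k) < norm (M *v axis j 1 - M' *v axis j 1)"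
        using reals_Archimedean by blast
      moreover have "norm (M *v axis j 1 - M' *v axis j 1) < inverse (Suc k)"
        using w[of j k] that by (auto simp: G_def)
      ultimately show False by simp
    qed
    then show ?thesis
      by (simp add: matrix_vector_mult_basis column_def vec_eq_iff)
  qed
  have wD: "w \<in> D" "dist w z < e"
    using wS r by (auto simp: S_def dist_commute)
  then obtain M where "M \<in> J w"
    using J unfolding conservative_jac_on_def by blast
  then have "J w = {M}"
    using eq by blast
  then show ?thesis
    using that wD by blast
qed

text \<open>Upper semicontinuity keeps all values of \<open>J\<close> near \<open>z\<close> close to
  \<open>A\<close>; the mean value inequality with \<open>r = A *v (y - z)\<close> turns this
  closeness into the first-order estimate.\<close>

lemma conservative_jac_singleton_imp_has_derivative:
  fixes F :: "real^'a \<Rightarrow> real^'b"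
  assumes J: "conservative_jac_on D F J" and lip: "loc_lipschitz_on D F" and "open D" "z \<in> D" "J z = {A}"
  shows "(F has_derivative (\<lambda>h. A *v h)) (at z)"
proof -
  have us: "usco_on D J"
    using J by (simp add: conservative_jac_on_iff)
  obtain C where C: "C > 0" "\<And>(M::real^'a^'b) h. norm (M *v h) \<le> norm M * norm h * C"
    using bounded_bilinear.pos_bounded[OF bounded_bilinear_matrix_vector_mult] by blast
  obtain e L where e: "e > 0" "L-lipschitz_on (ball z e \<inter> D) F"
    using lip \<open>z \<in> D\<close> unfolding loc_lipschitz_on_def by blast
  obtain e' where e': "e' > 0" "ball z e' \<subseteq> D"
    using \<open>open D\<close> \<open>z \<in> D\<close> open_contains_ball by blast
  have "\<exists>d>0. \<forall>y. norm (y - z) < d \<longrightarrow> norm (F y - F z - A *v (y - z)) \<le> \<epsilon> * norm (y - z)" if "\<epsilon> > 0" for \<epsilon>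
  proof -
    have "J z \<subseteq> ball A (\<epsilon> / C)"
      using that C \<open>J z = {A}\<close> by auto
    then obtain d where d: "d > 0" "\<And>w. w \<in> D \<Longrightarrow> dist w z < d \<Longrightarrow> J w \<subseteq> ball A (\<epsilon> / C)"
      using usco_on_nbhd[OF us \<open>z \<in> D\<close> open_ball] by blast
    \<comment> \<open>The radii \<open>d\<close>, \<open>e\<close>, \<open>e'\<close> ensure
      respectively that \<open>J\<close> is within \<open>\<epsilon> / C\<close> of
      \<open>A\<close>, that \<open>F\<close> is Lipschitz, and that the ball lies in
      \<open>D\<close>.\<close>
    define U where "U = ball z (Min {d, e, e'})"
    have U: "U \<subseteq> D" "U \<subseteq> ball z e" "\<And>w. w \<in> U \<Longrightarrow> dist w z < d" "convex U" "z \<in> U"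
      using e' d e by (auto simp: U_def dist_commute)
    have lipU: "L-lipschitz_on U F"
      by (rule lipschitz_on_subset[OF e(2)]) (use U in auto)
    have "norm (F y - F z - A *v (y - z)) \<le> \<epsilon> * norm (y - z)" if "y \<in> U" for y
    proof -
      have "norm (F (z + (y - z)) - F z - A *v (y - z)) \<le> \<epsilon> * norm (y - z)"
      proof (rule conservative_jac_mean_value[OF J \<open>convex U\<close> U(1) lipU \<open>z \<in> U\<close>])
        fix w M assume "w \<in> U" "M \<in> J w"
        then have "M \<in> ball A (\<epsilon> / C)"
          using d(2)[of w] U(1,3) by blast
        then have "norm (M - A) < \<epsilon> / C"
          by (simp add: dist_norm norm_minus_commute)
        then have *: "norm (M - A) * C \<le> \<epsilon>"
          using C(1) by (simp add: field_simps)
        have "norm (M *v (y - z) - A *v (y - z)) \<le> norm (M - A) * norm (y - z) * C"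
          using C(2)[of "M - A"] by (simp add: matrix_vector_mult_diff_rdistrib)
        also have "\<dots> \<le> \<epsilon> * norm (y - z)"
          using mult_right_mono[OF *, of "norm (y - z)"] by (simp add: mult_ac)
        finally show "norm (M *v (y - z) - A *v (y - z)) \<le> \<epsilon> * norm (y - z)" .
      qed (use that in auto)
      then show ?thesis by simp
    qed
    then show ?thesis
      using d e e' by (intro exI[of _ "Min {d, e, e'}"]) (auto simp: U_def dist_norm norm_minus_commute)
  qed
  then show ?thesis
    by (simp add: has_derivative_at_alt)
qed

text \<open>The limiting (Bouligand) Jacobian, whose convex hull is the Clarke Jacobian. As a slice
  of a closure it has a closed graph by construction.\<close>

definition jac_limits :: "(real^'a \<Rightarrow> real^'b) \<Rightarrow> real^'a \<Rightarrow> (real^'a^'b) set" where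
  "jac_limits F z = {M. (z, M) \<in> closure {(y, jacobian F (at y)) | y. F differentiable (at y)}}"

lemma clarke_jac_eq: "clarke_jac F z = convex hull (jac_limits F z)"
proof -
  have "(z, M) \<in> closure {(y, jacobian F (at y)) | y. F differentiable (at y)} \<longleftrightarrow>
    (\<exists>zs. zs \<longlonglongrightarrow> z \<and> (\<forall>j. F differentiable (at (zs j))) \<and> (\<lambda>j. jacobian F (at (zs j))) \<longlonglongrightarrow> M)" for M
  proof
    assume "(z, M) \<in> closure {(y, jacobian F (at y)) | y. F differentiable (at y)}"
    then obtain x where x: "\<And>n. x n \<in> {(y, jacobian F (at y)) | y. F differentiable (at y)}" "x \<longlonglongrightarrow> (z, M)"
      unfolding closure_sequential by blast
    have "F differentiable (at (fst (x n))) \<and> snd (x n) = jacobian F (at (fst (x n)))" for n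
      using x(1)[of n] by auto
    then show "\<exists>zs. zs \<longlonglongrightarrow> z \<and> (\<forall>j. F differentiable (at (zs j))) \<and> (\<lambda>j. jacobian F (at (zs j))) \<longlonglongrightarrow> M"
      using tendsto_fst[OF x(2)] tendsto_snd[OF x(2)] by (intro exI[of _ "\<lambda>n. fst (x n)"]) auto
  next
    assume "\<exists>zs. zs \<longlonglongrightarrow> z \<and> (\<forall>j. F differentiable (at (zs j))) \<and> (\<lambda>j. jacobian F (at (zs j))) \<longlonglongrightarrow> M"
    then obtain zs where zs: "zs \<longlonglongrightarrow> z" "\<forall>j. F differentiable (at (zs j))" "(\<lambda>j. jacobian F (at (zs j))) \<longlonglongrightarrow> M"
      by blast
    then show "(z, M) \<in> closure {(y, jacobian F (at y)) | y. F differentiable (at y)}"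
      unfolding closure_sequential
      by (intro exI[of _ "\<lambda>j. (zs j, jacobian F (at (zs j)))"]) (auto intro!: tendsto_Pair)
  qed
  then show ?thesis
    unfolding clarke_jac_def jac_limits_def by simp
qed

text \<open>Closedness carries \<open>P\<close> to limits of classical Jacobians and convexity
  carries it to their hull, so properties need checking only at points of differentiability.\<close>

lemma clarke_jac_induct:
  assumes "open U" "z \<in> U" "closed P" "convex P"
    and "\<And>y. y \<in> U \<Longrightarrow> F differentiable (at y) \<Longrightarrow> jacobian F (at y) \<in> P"
  shows "clarke_jac F z \<subseteq> P"
  unfolding clarke_jac_eq
proof (rule hull_minimal)
  have "jac_limits F z \<subseteq> closure P"
  proof
    fix M assume M: "M \<in> jac_limits F z"
    let ?G = "{(y, jacobian F (at y)) | y. F differentiable (at y)}"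
    \<comment> \<open>Since \<open>U\<close> is open, the approximating points may be taken in
      \<open>U\<close>, where classical Jacobians lie in \<open>P\<close>.\<close>
    have "(z, M) \<in> (U \<times> UNIV) \<inter> closure ?G"
      using M assms(2) by (simp add: jac_limits_def)
    also have "\<dots> \<subseteq> closure ((U \<times> UNIV) \<inter> ?G)"
      by (rule open_Int_closure_subset) (simp add: assms(1) open_Times)
    also have "\<dots> \<subseteq> closure (UNIV \<times> P)"
      using assms(5) by (intro closure_mono) auto
    finally show "M \<in> closure P"
      by (simp add: closure_Times)
  qed
  then show "jac_limits F z \<subseteq> P"
    using assms(3) by simp
qed (use assms in auto)

lemma jacobian_mult_tendsto:
  fixes F :: "real^'a \<Rightarrow> real^'b"
  assumes "F differentiable (at y)"
  shows "((\<lambda>t. (F (y + t *\<^sub>R v) - F y) /\<^sub>R t) \<longlongrightarrow> jacobian F (at y) *v v) (at_right 0)"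
proof -
  have "(F has_derivative (\<lambda>h. jacobian F (at y) *v h)) (at y)"
    using assms jacobian_works by blast
  then have "((\<lambda>t. F (y + t *\<^sub>R v)) has_derivative (\<lambda>t. jacobian F (at y) *v (t *\<^sub>R v))) (at 0)"
    by (intro has_derivative_compose[where f = "\<lambda>t. y + t *\<^sub>R v" and g = F, simplified])
       (auto intro!: derivative_eq_intros)
  then have "((\<lambda>t. F (y + t *\<^sub>R v)) has_vector_derivative jacobian F (at y) *v v) (at 0)"
    by (simp add: has_vector_derivative_def matrix_vector_mult_scaleR)
  then have "((\<lambda>t. norm (F (y + t *\<^sub>R v) - F y - t *\<^sub>R (jacobian F (at y) *v v)) / norm t) \<longlongrightarrow> 0) (at 0)"
    by (simp add: has_vector_derivative_def has_derivative_at)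
  then have "((\<lambda>t. norm (F (y + t *\<^sub>R v) - F y - t *\<^sub>R (jacobian F (at y) *v v)) / norm t) \<longlongrightarrow> 0) (at_right 0)"
    by (rule tendsto_mono[rotated]) (simp add: at_le)
  moreover have "\<forall>\<^sub>F t::real in at_right 0.
      norm (F (y + t *\<^sub>R v) - F y - t *\<^sub>R (jacobian F (at y) *v v)) / norm t
      = norm ((F (y + t *\<^sub>R v) - F y) /\<^sub>R t - jacobian F (at y) *v v)"
    using eventually_at_right_less[of 0]
  proof eventually_elim
    case (elim t)
    then have "(F (y + t *\<^sub>R v) - F y) /\<^sub>R t - jacobian F (at y) *v v
        = (F (y + t *\<^sub>R v) - F y - t *\<^sub>R (jacobian F (at y) *v v)) /\<^sub>R t"
      by (simp add: algebra_simps)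
    then show ?case
      by (simp only: norm_scaleR norm_inverse) (simp add: divide_inverse)
  qed
  ultimately have "((\<lambda>t. norm ((F (y + t *\<^sub>R v) - F y) /\<^sub>R t - jacobian F (at y) *v v)) \<longlongrightarrow> 0) (at_right 0)"
    by (rule Lim_transform_eventually)
  then show ?thesis
    by (rule LIM_zero_cancel[OF tendsto_norm_zero_cancel])
qed

lemma jacobian_mult_in_closed:
  fixes F :: "real^'a \<Rightarrow> real^'b"
  assumes "F differentiable (at y)" "closed P" "open U" "y \<in> U"
    and "\<And>t. t > 0 \<Longrightarrow> y + t *\<^sub>R v \<in> U \<Longrightarrow> (F (y + t *\<^sub>R v) - F y) /\<^sub>R t \<in> P"
  shows "jacobian F (at y) *v v \<in> P"
proof (rule Lim_in_closed_set[OF assms(2) _ _ jacobian_mult_tendsto[OF assms(1)]])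
  have "((\<lambda>t. y + t *\<^sub>R v) \<longlongrightarrow> y + 0 *\<^sub>R v) (at_right 0)"
    by (intro tendsto_intros)
  then have "\<forall>\<^sub>F t in at_right 0. y + t *\<^sub>R v \<in> U"
    using assms(3,4) by (intro topological_tendstoD) auto
  moreover have "\<forall>\<^sub>F t::real in at_right 0. t > 0"
    by (simp add: eventually_at_right_less)
  ultimately show "\<forall>\<^sub>F t in at_right 0. (F (y + t *\<^sub>R v) - F y) /\<^sub>R t \<in> P"
    by eventually_elim (rule assms(5))
qed simp

lemma closed_matrix_vector_vimage:
  assumes "closed P"
  shows "closed {M :: real^'a^'b. M *v v \<in> P}"
proof -
  have "continuous_on UNIV (\<lambda>M :: real^'a^'b. M *v v)"
    using bounded_linear.continuous_on[OF bounded_bilinear.bounded_linear_left[OF bounded_bilinear_matrix_vector_mult]]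
    by (auto intro: continuous_on_id)
  then show ?thesis
    using continuous_closed_vimage[OF assms, of "\<lambda>M. M *v v"]
    by (simp add: vimage_def continuous_on_eq_continuous_at)
qed

lemma convex_matrix_vector_vimage:
  assumes "convex P"
  shows "convex {M :: real^'a^'b. M *v v \<in> P}"
proof (rule convexI)
  fix M N :: "real^'a^'b" and s t :: real
  assume "M \<in> {M. M *v v \<in> P}" "N \<in> {M. M *v v \<in> P}" "0 \<le> s" "0 \<le> t" "s + t = 1"
  then show "s *\<^sub>R M + t *\<^sub>R N \<in> {M. M *v v \<in> P}"
    using convexD[OF assms, of "M *v v" "N *v v" s t]
    by (simp add: matrix_vector_mult_add_rdistrib scaleR_matrix_vector_assoc)
qed

text \<open>Transfer principle behind all later facts on Clarke elements: the classical
  \<open>M *v v\<close> is a one-sided limit of difference quotients, and \<open>P\<close> is closed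
  and convex. Balls are the sets \<open>P\<close> that occur.\<close>

lemma clarke_jac_mult_in:
  fixes F :: "real^'a \<Rightarrow> real^'b"
  assumes "open U" "z \<in> U" "closed P" "convex P" "M \<in> clarke_jac F z"
    and "\<And>y t. y \<in> U \<Longrightarrow> t > 0 \<Longrightarrow> y + t *\<^sub>R v \<in> U \<Longrightarrow> (F (y + t *\<^sub>R v) - F y) /\<^sub>R t \<in> P"
  shows "M *v v \<in> P"
proof -
  have "clarke_jac F z \<subseteq> {M. M *v v \<in> P}"
    using assms
    by (intro clarke_jac_induct[OF assms(1,2)] closed_matrix_vector_vimage convex_matrix_vector_vimage)
       (auto intro: jacobian_mult_in_closed)
  then show ?thesis
    using assms by blast
qed

text \<open>The norm on matrices is the Euclidean one and not the operator norm, hence the detour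
  through entries: each is a component of \<open>M *v axis j 1\<close>.\<close>

lemma bounded_matrices_le:
  "bounded {M :: real^'a^'b. \<forall>v. norm (M *v v) \<le> L * norm v}"
proof -
  have "norm M \<le> (\<Sum>i\<in>(UNIV::'b set). \<Sum>j\<in>(UNIV::'a set). L)" if "\<forall>v. norm (M *v v) \<le> L * norm v" for M :: "real^'a^'b"
  proof -
    have "\<bar>M $ i $ j\<bar> \<le> L" for i j
    proof -
      have "\<bar>M $ i $ j\<bar> = \<bar>(M *v axis j 1) $ i\<bar>"
        by (simp add: matrix_vector_mult_basis column_def)
      also have "\<dots> \<le> norm (M *v axis j 1)"
        by (rule component_le_norm_cart)
      also have "\<dots> \<le> L"
        using that[rule_format, of "axis j 1"] by simp
      finally show ?thesis .
    qed
    then have "norm (M $ i) \<le> (\<Sum>j\<in>(UNIV::'a set). L)" for i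
      by (intro order_trans[OF norm_le_l1_cart] sum_mono)
    then have "(\<Sum>i\<in>UNIV. norm (M $ i)) \<le> (\<Sum>i\<in>(UNIV::'b set). \<Sum>j\<in>(UNIV::'a set). L)"
      by (rule sum_mono)
    moreover have "norm M \<le> (\<Sum>i\<in>UNIV. norm (M $ i))"
      unfolding norm_vec_def[of M] by (rule L2_set_le_sum) simp
    ultimately show ?thesis
      by linarith
  qed
  then show ?thesis
    unfolding bounded_iff by blast
qed

lemma clarke_jac_lipschitz:
  fixes F :: "real^'a \<Rightarrow> real^'b"
  assumes "open U" "z \<in> U" "L-lipschitz_on U F" "M \<in> clarke_jac F z"
  shows "norm (M *v v) \<le> L * norm v"
proof -
  have "M *v v \<in> cball 0 (L * norm v)"
  proof (rule clarke_jac_mult_in[OF assms(1,2) _ _ assms(4)])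
    fix y t assume yt: "y \<in> U" "t > 0" "y + t *\<^sub>R v \<in> U"
    have "norm (F (y + t *\<^sub>R v) - F y) \<le> L * norm (t *\<^sub>R v)"
      using assms(3) yt lipschitz_on_normD by fastforce
    then show "(F (y + t *\<^sub>R v) - F y) /\<^sub>R t \<in> cball 0 (L * norm v)"
      using yt(2) by (simp add: divide_simps mult_ac)
  qed auto
  then show ?thesis by simp
qed

lemma usco_on_jac_limits:
  fixes F :: "real^'a \<Rightarrow> real^'b"
  assumes lip: "loc_lipschitz_on D F" and "open D"
  shows "usco_on D (jac_limits F)"
  unfolding usco_on_def
proof (intro conjI ballI)
  fix z assume "z \<in> D"
  then obtain e L where e: "e > 0" "L-lipschitz_on (ball z e \<inter> D) F"
    using lip unfolding loc_lipschitz_on_def by blast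
  have "norm (M *v v) \<le> L * norm v" if "w \<in> ball z e \<inter> D" "M \<in> jac_limits F w" for w M v
    using that clarke_jac_lipschitz[OF _ that(1) e(2), of M v] \<open>open D\<close>
    by (auto simp: clarke_jac_eq hull_inc)
  then have "(\<Union>w\<in>ball z e \<inter> D. jac_limits F w) \<subseteq> {M. \<forall>v. norm (M *v v) \<le> L * norm v}"
    by blast
  then show "\<exists>e>0. bounded (\<Union>w\<in>ball z e \<inter> D. jac_limits F w)"
    using e(1) bounded_subset[OF bounded_matrices_le] by blast
next
  have "{(z, M). z \<in> D \<and> M \<in> jac_limits F z}
      = (D \<times> UNIV) \<inter> closure {(y, jacobian F (at y)) | y. F differentiable (at y)}"
    by (auto simp: jac_limits_def)
  then show "closedin (top_of_set (D \<times> UNIV)) {(z, M). z \<in> D \<and> M \<in> jac_limits F z}"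
    by (simp add: closedin_closed_Int)
qed

lemma clarke_jac_mult_eq:
  fixes F :: "real^'a \<Rightarrow> real^'b"
  assumes J: "conservative_jac_on D F J" and lip: "loc_lipschitz_on D F" and "open D" "z \<in> D"
    and eq: "\<And>A. A \<in> J z \<Longrightarrow> A *v v = r" and M: "M \<in> clarke_jac F z"
  shows "M *v v = r"
proof -
  have us: "usco_on D J"
    using J by (simp add: conservative_jac_on_iff)
  obtain e L where e: "e > 0" "L-lipschitz_on (ball z e \<inter> D) F"
    using lip \<open>z \<in> D\<close> unfolding loc_lipschitz_on_def by blast
  obtain e' where e': "e' > 0" "ball z e' \<subseteq> D"
    using \<open>open D\<close> \<open>z \<in> D\<close> open_contains_ball by blast
  have "norm (M *v v - r) \<le> \<epsilon>" if "\<epsilon> > 0" for \<epsilon>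
  proof -
    \<comment> \<open>\<open>V\<close> restricts only the action on \<open>v\<close>, so
      \<open>J z \<subseteq> V\<close> follows from agreement in this one direction even if
      \<open>J z\<close> has many elements.\<close>
    define V where "V = {A :: real^'a^'b. A *v v \<in> ball r \<epsilon>}"
    have "V = - {A. A *v v \<in> - ball r \<epsilon>}"
      by (auto simp: V_def)
    then have "open V"
      using closed_matrix_vector_vimage[of "- ball r \<epsilon>" v] by (simp add: open_Compl closed_Compl)
    moreover have "J z \<subseteq> V"
      using eq that by (auto simp: V_def)
    ultimately obtain d where d: "d > 0" "\<And>w. w \<in> D \<Longrightarrow> dist w z < d \<Longrightarrow> J w \<subseteq> V"
      using usco_on_nbhd[OF us \<open>z \<in> D\<close>] by blast
    define U where "U = ball z (Min {d, e, e'})"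
    have U: "U \<subseteq> D" "U \<subseteq> ball z e" "\<And>w. w \<in> U \<Longrightarrow> dist w z < d" "convex U" "z \<in> U" "open U"
      using e' d e by (auto simp: U_def dist_commute)
    have lipU: "L-lipschitz_on U F"
      by (rule lipschitz_on_subset[OF e(2)]) (use U in auto)
    have "M *v v \<in> cball r \<epsilon>"
    proof (rule clarke_jac_mult_in[OF U(6,5) _ _ M])
      fix y t assume yt: "y \<in> U" "(t::real) > 0" "y + t *\<^sub>R v \<in> U"
      have "norm (F (y + t *\<^sub>R v) - F y - t *\<^sub>R r) \<le> t * \<epsilon>"
      proof (rule conservative_jac_mean_value[OF J \<open>convex U\<close> U(1) lipU yt(1,3)])
        fix w A assume "w \<in> U" "A \<in> J w"
        then have "A \<in> V"
          using d(2)[of w] U(1,3) by blast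
        then have "norm (A *v v - r) \<le> \<epsilon>"
          by (simp add: V_def dist_norm norm_minus_commute)
        then show "norm (A *v (t *\<^sub>R v) - t *\<^sub>R r) \<le> t * \<epsilon>"
          using yt(2) by (simp add: matrix_vector_mult_scaleR scaleR_diff_right[symmetric])
      qed
      moreover have "F (y + t *\<^sub>R v) - F y - t *\<^sub>R r = t *\<^sub>R ((F (y + t *\<^sub>R v) - F y) /\<^sub>R t - r)"
        using yt(2) by (simp add: algebra_simps)
      ultimately show "(F (y + t *\<^sub>R v) - F y) /\<^sub>R t \<in> cball r \<epsilon>"
        using yt(2) by (simp add: dist_norm norm_minus_commute)
    qed auto
    then show ?thesis
      by (simp add: dist_norm norm_minus_commute)
  qed
  then have "norm (M *v v - r) \<le> 0"
    by (rule field_le_epsilon[of _ 0, simplified])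
  then show ?thesis
    by simp
qed

theorem clarke_jac_conservative:
  fixes F :: "real^'a \<Rightarrow> real^'b"
  assumes "path_differentiable_on D F" "open D"
  shows "conservative_jac_on D F (clarke_jac F)"
proof -
  obtain J where J: "conservative_jac_on D F J" and lip: "loc_lipschitz_on D F"
    using assms(1) unfolding path_differentiable_on_def by blast
  have us: "usco_on D (jac_limits F)"
    using usco_on_jac_limits[OF lip assms(2)] .
  show ?thesis
    unfolding conservative_jac_on_iff
  proof (intro conjI ballI allI impI)
    fix z assume "z \<in> D"
    have "\<exists>w M. w \<in> D \<and> dist w z < inverse (real (Suc n)) \<and> J w = {M}" for n
      using conservative_jac_singleton_dense[OF J assms(2) \<open>z \<in> D\<close>, of "inverse (real (Suc n))"]
      by (metis inverse_positive_iff_positive of_nat_0_less_iff zero_less_Suc)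
    then obtain ws Ms where ws: "\<And>n. ws n \<in> D" "\<And>n. dist (ws n) z < inverse (real (Suc n))" "\<And>n. J (ws n) = {Ms n}"
      by metis
    have "(\<lambda>n. dist (ws n) z) \<longlonglongrightarrow> 0"
      by (rule tendsto_sandwich[OF _ _ tendsto_const LIMSEQ_inverse_real_of_nat])
         (use ws(2) in \<open>auto intro!: always_eventually less_imp_le\<close>)
    then have lim: "ws \<longlonglongrightarrow> z"
      using tendsto_dist_iff by blast
    have "jacobian F (at (ws n)) \<in> jac_limits F (ws n)" for n
    proof -
      have "F differentiable (at (ws n))"
        using conservative_jac_singleton_imp_has_derivative[OF J lip assms(2) ws(1,3)] differentiableI by blast
      then show ?thesis
        unfolding jac_limits_def using closure_subset by fast
    qed
    then have "jac_limits F z \<noteq> {}"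
      using usco_on_subseq[OF us \<open>z \<in> D\<close> ws(1) lim, of "\<lambda>n. jacobian F (at (ws n))"] by blast
    then show "clarke_jac F z \<noteq> {}"
      by (simp add: clarke_jac_eq)
  next
    have "usco_on D (\<lambda>z. convex hull (jac_limits F z))"
      by (rule usco_on_convex_hull[OF us])
    then show "usco_on D (clarke_jac F)"
      by (simp add: clarke_jac_eq[abs_def])
  next
    fix c assume c: "abs_continuous_curve c \<and> c ` {0..1} \<subseteq> D"
    then have "AE t in lebesgue_on {0..1}. \<exists>c'. (c has_vector_derivative c') (at t)
          \<and> (\<forall>M\<in>J (c t). ((F \<circ> c) has_vector_derivative (M *v c')) (at t))"
      using J unfolding conservative_jac_on_def by blast
    moreover have "AE t in lebesgue_on {0..1}. t \<in> {0..1}"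
      using AE_space[of "lebesgue_on {0..1}"] by simp
    ultimately show "AE t in lebesgue_on {0..1}. \<exists>c'. (c has_vector_derivative c') (at t)
          \<and> (\<forall>M\<in>clarke_jac F (c t). ((F \<circ> c) has_vector_derivative (M *v c')) (at t))"
    proof eventually_elim
      case (elim t)
      then obtain c' where c': "(c has_vector_derivative c') (at t)"
        "\<forall>M\<in>J (c t). ((F \<circ> c) has_vector_derivative (M *v c')) (at t)" by blast
      have "c t \<in> D"
        using c elim(2) by blast
      then obtain A where A: "A \<in> J (c t)"
        using J unfolding conservative_jac_on_def by blast
      have "A' *v c' = A *v c'" if "A' \<in> J (c t)" for A'
        using c'(2) A that vector_derivative_unique_at by blast
      then have "M *v c' = A *v c'" if "M \<in> clarke_jac F (c t)" for M
        using clarke_jac_mult_eq[OF J lip assms(2) \<open>c t \<in> D\<close> _ that] by blast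
      then show ?case
        using c' A by (intro exI[of _ c']) auto
    qed
  qed
qed

section \<open>Block vectors and proximal maps\<close>

lemma vfst_vjoin [simp]: "vfst (vjoin u v) = u"
  by (simp add: vfst_def vjoin_def vec_eq_iff)

lemma vsnd_vjoin [simp]: "vsnd (vjoin u v) = v"
  by (simp add: vsnd_def vjoin_def vec_eq_iff)

lemma vjoin_vfst_vsnd [simp]: "vjoin (vfst w) (vsnd w) = w"
  by (auto simp: vfst_def vsnd_def vjoin_def vec_eq_iff split: sum.split)

lemma vec_sum_eqI: "vfst x = vfst y \<Longrightarrow> vsnd x = vsnd y \<Longrightarrow> x = y"
  by (metis vjoin_vfst_vsnd)

lemma vec_sum_eq_iff: "x = y \<longleftrightarrow> vfst x = vfst y \<and> vsnd x = vsnd y"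
  using vec_sum_eqI by blast

lemma linear_vfst: "linear vfst"
  by (rule linearI) (auto simp: vfst_def vec_eq_iff)

lemma linear_vsnd: "linear vsnd"
  by (rule linearI) (auto simp: vsnd_def vec_eq_iff)

lemmas vfst_simps [simp] =
  linear_add[OF linear_vfst] linear_diff[OF linear_vfst] linear_cmul[OF linear_vfst]
  linear_neg[OF linear_vfst] linear_0[OF linear_vfst]
lemmas vsnd_simps [simp] =
  linear_add[OF linear_vsnd] linear_diff[OF linear_vsnd] linear_cmul[OF linear_vsnd]
  linear_neg[OF linear_vsnd] linear_0[OF linear_vsnd]

lemma sum_UNIV_sum:
  fixes h :: "'a::finite + 'b::finite \<Rightarrow> 'c::comm_monoid_add"
  shows "sum h UNIV = (\<Sum>i\<in>UNIV. h (Inl i)) + (\<Sum>i\<in>UNIV. h (Inr i))"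
  unfolding UNIV_Plus_UNIV[symmetric] by (subst sum.Plus) auto

lemma inner_vec_sum:
  fixes x y :: "real^('a::finite + 'b::finite)"
  shows "x \<bullet> y = vfst x \<bullet> vfst y + vsnd x \<bullet> vsnd y"
  by (simp add: inner_vec_def sum_UNIV_sum vfst_def vsnd_def)

lemma norm_vec_sum_power2:
  fixes x :: "real^('a::finite + 'b::finite)"
  shows "(norm x)\<^sup>2 = (norm (vfst x))\<^sup>2 + (norm (vsnd x))\<^sup>2"
  by (simp only: power2_norm_eq_inner inner_vec_sum)

lemma norm_vfst_le: "norm (vfst x) \<le> norm x"
  by (rule power2_le_imp_le) (simp_all add: norm_vec_sum_power2[of x])

lemma norm_vsnd_le: "norm (vsnd x) \<le> norm x"
  by (rule power2_le_imp_le) (simp_all add: norm_vec_sum_power2[of x])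

lemma norm_vec_sum_le: "norm x \<le> norm (vfst x) + norm (vsnd x)"
  by (rule power2_le_imp_le) (simp_all add: norm_vec_sum_power2[of x] power2_sum)

lemma matrix_vector_mult_blocks:
  fixes M :: "real^('a::finite + 'b::finite)^'c"
  shows "M *v x = mblockL M *v vfst x + mblockR M *v vsnd x"
  by (simp add: vec_eq_iff matrix_vector_mult_def sum_UNIV_sum vfst_def vsnd_def mblockL_def mblockR_def)

section \<open>Strong convexity, subgradients and proximal maps\<close>

lemma le_of_le_small_perturbation:
  fixes X Y b :: real
  assumes "\<And>t. 0 < t \<Longrightarrow> t < 1 \<Longrightarrow> X - t * Y \<le> b"
  shows "X \<le> b"
proof (rule tendsto_upperbound)
  have "((\<lambda>t. X - t * Y) \<longlongrightarrow> X - 0 * Y) (at_right 0)"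
    by (intro tendsto_intros)
  then show "((\<lambda>t. X - t * Y) \<longlongrightarrow> X) (at_right 0)"
    by simp
  have "\<forall>\<^sub>F t in at_right (0::real). t \<in> {0<..<1}"
    by (rule eventually_at_right_real) simp
  then show "\<forall>\<^sub>F t in at_right 0. X - t * Y \<le> b"
    by eventually_elim (use assms in auto)
qed simp

lemma strongly_convex_real:
  assumes "strongly_convex \<alpha> g" "g x = ereal a" "g y = ereal b" "0 \<le> t" "t \<le> 1"
  shows "g (t *\<^sub>R x + (1 - t) *\<^sub>R y) \<le> ereal (t * a + (1 - t) * b - \<alpha> / 2 * t * (1 - t) * (norm (x - y))\<^sup>2)"
  using assms(1)[unfolded strongly_convex_def, rule_format, of t x y] assms(2-5) by simp

lemma proper_fun_cases:
  assumes "proper_fun g"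
  obtains r where "g v = ereal r" | "g v = \<infinity>"
  using assms by (cases "g v") (auto simp: proper_fun_def)

lemma subdiff_finite:
  assumes "proper_fun g" "s \<in> subdiff g u"
  obtains r where "g u = ereal r"
proof (rule proper_fun_cases[OF assms(1), of u])
  assume "g u = \<infinity>"
  moreover have "g u + ereal (s \<bullet> (y - u)) \<le> g y" for y
    using assms(2) by (auto simp: subdiff_def)
  ultimately have "g y = \<infinity>" for y
    by (metis ereal_infty_less_eq(1) plus_ereal.simps(2))
  then show ?thesis
    using assms(1) by (auto simp: proper_fun_def)
qed (use that in auto)

lemma subdiff_real:
  assumes "s \<in> subdiff g u" "g u = ereal a" "g v = ereal b"
  shows "a + s \<bullet> (v - u) \<le> b"
proof -
  have "g u + ereal (s \<bullet> (v - u)) \<le> g v"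
    using assms(1) by (auto simp: subdiff_def)
  then show ?thesis
    using assms(2,3) by simp
qed

text \<open>The quadratic gain appears by testing the subgradient inequality at
  \<open>t *\<^sub>R v + (1 - t) *\<^sub>R u\<close>, bounding \<open>g\<close> there by strong
  convexity, dividing by \<open>t\<close> and letting \<open>t\<close> tend to 0.\<close>

lemma strongly_convex_subdiff:
  fixes g :: "'a::real_inner \<Rightarrow> ereal"
  assumes "proper_fun g" "strongly_convex \<alpha> g" "s \<in> subdiff g u" "g u = ereal a" "g v = ereal b"
  shows "a + s \<bullet> (v - u) + \<alpha> / 2 * (norm (v - u))\<^sup>2 \<le> b"
proof (rule le_of_le_small_perturbation)
  fix t :: real assume t: "0 < t" "t < 1"
  define p where "p = t *\<^sub>R v + (1 - t) *\<^sub>R u"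
  have gp: "g p \<le> ereal (t * b + (1 - t) * a - \<alpha> / 2 * t * (1 - t) * (norm (v - u))\<^sup>2)"
    unfolding p_def using assms t by (intro strongly_convex_real) auto
  then obtain c where c: "g p = ereal c"
    using proper_fun_cases[OF assms(1), of p] by (metis ereal_infty_less_eq(1) PInfty_neq_ereal(1))
  have "p - u = t *\<^sub>R (v - u)"
    by (simp add: p_def algebra_simps)
  then have "a + t * (s \<bullet> (v - u)) \<le> c"
    using subdiff_real[OF assms(3,4) c] by simp
  moreover have "c \<le> t * b + (1 - t) * a - \<alpha> / 2 * t * (1 - t) * (norm (v - u))\<^sup>2"
    using gp c by simp
  moreover have "t * (a + s \<bullet> (v - u) + \<alpha> / 2 * (norm (v - u))\<^sup>2 - t * (\<alpha> / 2 * (norm (v - u))\<^sup>2))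
      = (a + t * (s \<bullet> (v - u))) + (t * b - (t * b + (1 - t) * a - \<alpha> / 2 * t * (1 - t) * (norm (v - u))\<^sup>2))"
    by (simp add: field_simps)
  ultimately have "t * (a + s \<bullet> (v - u) + \<alpha> / 2 * (norm (v - u))\<^sup>2 - t * (\<alpha> / 2 * (norm (v - u))\<^sup>2)) \<le> t * b"
    by linarith
  then show "a + s \<bullet> (v - u) + \<alpha> / 2 * (norm (v - u))\<^sup>2 - t * (\<alpha> / 2 * (norm (v - u))\<^sup>2) \<le> b"
    using t(1) by simp
qed

lemma subdiff_strongly_monotone:
  fixes g :: "'a::real_inner \<Rightarrow> ereal"
  assumes "proper_fun g" "strongly_convex \<alpha> g" "s \<in> subdiff g u" "s' \<in> subdiff g u'"
  shows "\<alpha> * (norm (u - u'))\<^sup>2 \<le> (s - s') \<bullet> (u - u')"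
proof -
  obtain a where a: "g u = ereal a" using subdiff_finite[OF assms(1,3)] .
  obtain b where b: "g u' = ereal b" using subdiff_finite[OF assms(1,4)] .
  show ?thesis
    using strongly_convex_subdiff[OF assms(1,2,3) a b] strongly_convex_subdiff[OF assms(1,2,4) b a]
    by (simp add: algebra_simps norm_minus_commute)
qed

text \<open>Direct method: a minimizing sequence accumulates at some \<open>u\<close>, and the
  closed epigraph gives \<open>g u \<le> s\<close> for every real \<open>s\<close> above the
  infimum. Working with real \<open>s\<close> also covers infinite infima.\<close>

lemma closed_fun_attains_inf:
  fixes g :: "'a::metric_space \<Rightarrow> ereal"
  assumes "closed_fun g" "compact C" "C \<noteq> {}"
  obtains u where "u \<in> C" "\<And>v. v \<in> C \<Longrightarrow> g u \<le> g v"
proof -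
  obtain y where y: "\<And>n. y n \<in> g ` C" "y \<longlonglongrightarrow> Inf (g ` C)"
    using Inf_as_limit[of "g ` C"] assms(3) by auto
  then have "\<exists>x. x \<in> C \<and> g x = y n" for n
    by (metis imageE)
  then obtain x where x: "\<And>n. x n \<in> C" "\<And>n. g (x n) = y n"
    by metis
  obtain u r where u: "u \<in> C" "strict_mono r" "(x \<circ> r) \<longlonglongrightarrow> u"
    using assms(2) x(1) unfolding compact_def by metis
  have lim: "(\<lambda>n. g ((x \<circ> r) n)) \<longlonglongrightarrow> Inf (g ` C)"
    using LIMSEQ_subseq_LIMSEQ[OF y(2) u(2)] x(2) by (simp add: o_def)
  have "g u \<le> ereal s" if "Inf (g ` C) < ereal s" for s
  proof -
    have "\<forall>\<^sub>F n in sequentially. ((x \<circ> r) n, s) \<in> {(x, t). g x \<le> ereal t}"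
      using order_tendstoD(2)[OF lim that] by eventually_elim auto
    moreover have "(\<lambda>n. ((x \<circ> r) n, s)) \<longlonglongrightarrow> (u, s)"
      by (intro tendsto_Pair u(3) tendsto_const)
    ultimately have "(u, s) \<in> {(x, t). g x \<le> ereal t}"
      using assms(1) unfolding closed_fun_def by (intro Lim_in_closed_set[of _ _ sequentially]) auto
    then show ?thesis by simp
  qed
  then have "g u \<le> Inf (g ` C)"
    by (metis ereal_dense2 leI less_le_not_le not_le)
  then have "g u \<le> g v" if "v \<in> C" for v
    using that by (meson INF_lower order_trans)
  then show ?thesis
    using that u(1) by blast
qed

lemma closed_fun_add_continuous:
  fixes g :: "'a::metric_space \<Rightarrow> ereal"
  assumes "closed_fun g" "continuous_on UNIV h"
  shows "closed_fun (\<lambda>u. g u + ereal (h u))"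
proof -
  have "g x + ereal (h x) \<le> ereal t \<longleftrightarrow> g x \<le> ereal (t - h x)" for x t
    by (cases "g x") auto
  then have eq: "{(x, t::real). g x + ereal (h x) \<le> ereal t} = (\<lambda>(x, t). (x, t - h x)) -` {(x, t). g x \<le> ereal t}"
    by auto
  have cont: "continuous_on UNIV (\<lambda>(x, t::real). (x, t - h x))"
    unfolding case_prod_beta
    by (intro continuous_intros continuous_on_compose2[OF assms(2)]) auto
  show ?thesis
    unfolding closed_fun_def eq by (rule closed_vimage[OF assms(1)[unfolded closed_fun_def] cont])
qed

text \<open>Compactness bounds \<open>g\<close> on a unit ball around a point of its domain. A point
  \<open>v\<close> outside is compared with the point \<open>p\<close> where the segment from
  \<open>x0\<close> to \<open>v\<close> meets the unit sphere; strong convexity then forces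
  quadratic growth of \<open>g v\<close>.\<close>

lemma strongly_convex_bounded_below:
  fixes g :: "'a::euclidean_space \<Rightarrow> ereal"
  assumes cl: "closed_fun g" and pr: "proper_fun g" and sc: "strongly_convex \<alpha> g" and "\<alpha> > 0"
  obtains m where "\<And>v. ereal m \<le> g v"
proof -
  obtain x0 a where a: "g x0 = ereal a"
    using pr by (metis proper_fun_def proper_fun_cases[OF pr])
  obtain u where u: "u \<in> cball x0 1" "\<And>v. v \<in> cball x0 1 \<Longrightarrow> g u \<le> g v"
    using closed_fun_attains_inf[OF cl compact_cball, of x0 1] by auto
  have "g u \<le> ereal a"
    using u(2)[of x0] a by simp
  then obtain m where m: "g u = ereal m"
    using proper_fun_cases[OF pr, of u] by force
  \<comment> \<open>Expanding the estimate at distance \<open>r\<close> in powers of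
    \<open>r - 1\<close> gives the lower bound
    \<open>m + k * (r - 1) + \<alpha> / 2 * (r - 1)\<^sup>2\<close>; completing the square yields
    the constant below.\<close>
  define k where "k = m - a + \<alpha> / 2"
  have "ereal (m - k\<^sup>2 / (2 * \<alpha>)) \<le> g v" for v
  proof (cases "v \<in> cball x0 1")
    case True
    have "ereal (m - k\<^sup>2 / (2 * \<alpha>)) \<le> ereal m"
      using \<open>\<alpha> > 0\<close> by simp
    also have "\<dots> \<le> g v"
      using u(2)[OF True] m by simp
    finally show ?thesis .
  next
    case False
    define r where "r = norm (v - x0)"
    have r: "r > 1"
      using False by (simp add: r_def dist_norm norm_minus_commute)
    show ?thesis
    proof (rule proper_fun_cases[OF pr, of v])
      fix b assume b: "g v = ereal b"
      define p where "p = (1/r) *\<^sub>R v + (1 - 1/r) *\<^sub>R x0"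
      have "p - x0 = (1/r) *\<^sub>R (v - x0)"
        by (simp add: p_def algebra_simps)
      then have "norm (p - x0) = 1"
        using r by (simp add: r_def[symmetric])
      then have "g u \<le> g p"
        by (intro u(2)) (simp add: dist_norm norm_minus_commute)
      also have "\<dots> \<le> ereal ((1/r) * b + (1 - 1/r) * a - \<alpha> / 2 * (1/r) * (1 - 1/r) * (norm (v - x0))\<^sup>2)"
        unfolding p_def using r by (intro strongly_convex_real[OF sc b a]) auto
      finally have "m \<le> (1/r) * b + (1 - 1/r) * a - \<alpha> / 2 * (1/r) * (1 - 1/r) * r\<^sup>2"
        using m by (simp add: r_def)
      then have "m * r \<le> ((1/r) * b + (1 - 1/r) * a - \<alpha> / 2 * (1/r) * (1 - 1/r) * r\<^sup>2) * r"
        using r by (intro mult_right_mono) auto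
      also have "\<dots> = b + (r - 1) * a - \<alpha> / 2 * (r - 1) * r"
        using r by (simp add: field_simps power2_eq_square)
      finally have "m + k * (r - 1) + \<alpha> / 2 * (r - 1)\<^sup>2 \<le> b"
        by (simp add: k_def field_simps power2_eq_square)
      moreover have "\<alpha> / 2 * (r - 1)\<^sup>2 + k * (r - 1) + k\<^sup>2 / (2 * \<alpha>) = \<alpha> / 2 * (r - 1 + k / \<alpha>)\<^sup>2"
        using \<open>\<alpha> > 0\<close> by (simp add: field_simps power2_eq_square)
      moreover have "0 \<le> \<alpha> / 2 * (r - 1 + k / \<alpha>)\<^sup>2"
        using \<open>\<alpha> > 0\<close> by simp
      ultimately have "m - k\<^sup>2 / (2 * \<alpha>) \<le> b"
        by linarith
      then show ?thesis
        using b by simp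
    qed simp
  qed
  then show ?thesis
    using that by blast
qed

lemma norm_diff_scaleR_power2:
  fixes d e :: "'a::real_inner"
  shows "(norm (d - t *\<^sub>R e))\<^sup>2 = (norm d)\<^sup>2 - 2 * t * (d \<bullet> e) + t\<^sup>2 * (norm e)\<^sup>2"
  unfolding power2_norm_eq_inner
  by (simp add: inner_diff_left inner_diff_right inner_commute[of e d] power2_eq_square algebra_simps)

text \<open>The inclusion is the optimality condition of a minimizer of \<open>g + h\<close>, the
  proximal objective divided by \<open>\<gamma>\<close>. The minimizer is found on a compact ball
  outside which \<open>h\<close> alone is large enough.\<close>

lemma prox_inclusion_exists:
  fixes g :: "'a::euclidean_space \<Rightarrow> ereal"
  assumes cl: "closed_fun g" and pr: "proper_fun g" and sc: "strongly_convex \<alpha> g" and "\<alpha> > 0" "\<gamma> > 0"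
  obtains u where "(x - u) /\<^sub>R \<gamma> \<in> subdiff g u"
proof -
  define h where "h u = (norm (x - u))\<^sup>2 / (2 * \<gamma>)" for u
  obtain m where m: "\<And>v. ereal m \<le> g v"
    using strongly_convex_bounded_below[OF cl pr sc \<open>\<alpha> > 0\<close>] by blast
  obtain x0 a0 where a0: "g x0 = ereal a0"
    using pr by (metis proper_fun_def proper_fun_cases[OF pr])
  \<comment> \<open>The ball must contain \<open>x0\<close>; outside it \<open>R \<ge> 1\<close>
    gives \<open>(norm (x - v))\<^sup>2 \<ge> R\<close>, so that \<open>m + h v\<close> is at least
    the value \<open>a0 + h x0\<close> at \<open>x0\<close>.\<close>
  define R where "R = Max {norm (x - x0), 1, 2 * \<gamma> * (a0 + h x0 - m)}"
  have R: "norm (x - x0) \<le> R" "1 \<le> R" "2 * \<gamma> * (a0 + h x0 - m) \<le> R"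
    by (auto simp: R_def)
  have "closed_fun (\<lambda>u. g u + ereal (h u))"
    unfolding h_def by (intro closed_fun_add_continuous[OF cl] continuous_intros) (use \<open>\<gamma> > 0\<close> in auto)
  then obtain u where u: "u \<in> cball x R" "\<And>v. v \<in> cball x R \<Longrightarrow> g u + ereal (h u) \<le> g v + ereal (h v)"
    using closed_fun_attains_inf[of "\<lambda>u. g u + ereal (h u)" "cball x R"] R(2) by auto
  have ux0: "g u + ereal (h u) \<le> ereal (a0 + h x0)"
    using u(2)[of x0] R(1) a0 by (simp add: dist_norm)
  then obtain a where a: "g u = ereal a"
    using proper_fun_cases[OF pr, of u] by force
  have min: "a + h u \<le> b + h v" if "g v = ereal b" for v b
  proof (cases "v \<in> cball x R")
    case True
    then show ?thesis
      using u(2)[OF True] a that by simp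
  next
    case False
    then have "R \<le> norm (x - v)"
      by (simp add: dist_norm)
    then have "R * 1 \<le> norm (x - v) * norm (x - v)"
      using R(2) by (intro mult_mono) auto
    then have "2 * \<gamma> * (a0 + h x0 - m) \<le> 2 * \<gamma> * h v"
      using R(3) \<open>\<gamma> > 0\<close> by (simp add: h_def power2_eq_square)
    then have "a0 + h x0 - m \<le> h v"
      using \<open>\<gamma> > 0\<close> by simp
    moreover have "m \<le> b"
      using m[of v] that by simp
    ultimately show ?thesis
      using ux0 a by simp
  qed
  \<comment> \<open>First-order condition: minimality is compared along the segment towards
    \<open>v\<close>; the quadratic part of \<open>h\<close> contributes only at order
    \<open>t\<^sup>2\<close> and disappears after division by \<open>t\<close>.\<close>
  have "a + ((x - u) /\<^sub>R \<gamma>) \<bullet> (v - u) \<le> b" if b: "g v = ereal b" for v b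
  proof (rule le_of_le_small_perturbation)
    fix t :: real assume t: "0 < t" "t < 1"
    define p where "p = t *\<^sub>R v + (1 - t) *\<^sub>R u"
    have "g p \<le> ereal (t * b + (1 - t) * a - \<alpha> / 2 * t * (1 - t) * (norm (v - u))\<^sup>2)"
      unfolding p_def using t by (intro strongly_convex_real[OF sc b a]) auto
    also have "\<dots> \<le> ereal (t * b + (1 - t) * a)"
      using t \<open>\<alpha> > 0\<close> by simp
    finally have gp: "g p \<le> ereal (t * b + (1 - t) * a)" .
    then obtain c where c: "g p = ereal c"
      using proper_fun_cases[OF pr, of p] by force
    have "x - p = (x - u) - t *\<^sub>R (v - u)"
      by (simp add: p_def algebra_simps)
    then have "(norm (x - p))\<^sup>2 = (norm (x - u))\<^sup>2 - 2 * t * ((x - u) \<bullet> (v - u)) + t\<^sup>2 * (norm (v - u))\<^sup>2"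
      by (simp only: norm_diff_scaleR_power2)
    then have "h p = h u - t * (((x - u) /\<^sub>R \<gamma>) \<bullet> (v - u)) + t * (t * ((norm (v - u))\<^sup>2 / (2 * \<gamma>)))"
      using \<open>\<gamma> > 0\<close> unfolding h_def inner_scaleR_left by (simp add: field_simps power2_eq_square)
    moreover have "a + h u \<le> c + h p"
      by (rule min[OF c])
    moreover have "c \<le> t * b + (1 - t) * a"
      using gp c by simp
    ultimately have "t * (a + ((x - u) /\<^sub>R \<gamma>) \<bullet> (v - u) - t * ((norm (v - u))\<^sup>2 / (2 * \<gamma>))) \<le> t * b"
      by (simp add: algebra_simps)
    then show "a + ((x - u) /\<^sub>R \<gamma>) \<bullet> (v - u) - t * ((norm (v - u))\<^sup>2 / (2 * \<gamma>)) \<le> b"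
      using t(1) by (rule mult_left_le_imp_le)
  qed
  then have "g u + ereal (((x - u) /\<^sub>R \<gamma>) \<bullet> (v - u)) \<le> g v" for v
    using a by (cases rule: proper_fun_cases[OF pr, of v]) simp_all
  then show ?thesis
    using that by (auto simp: subdiff_def)
qed

text \<open>Expanding the square leaves the surplus \<open>(norm (v - u))\<^sup>2 / 2\<close> in
  \<open>key\<close>. It gives minimality of \<open>u\<close> and forces every minimizer to equal
  \<open>u\<close>, as the definite description in \<open>prox\<close> requires.\<close>

lemma prox_eqI:
  fixes g :: "'a::real_inner \<Rightarrow> ereal"
  assumes pr: "proper_fun g" and "\<gamma> > 0" and s: "(x - u) /\<^sub>R \<gamma> \<in> subdiff g u"
  shows "prox (\<lambda>u. ereal \<gamma> * g u) x = u"
proof -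
  obtain a where a: "g u = ereal a"
    using subdiff_finite[OF pr s] .
  have key: "\<gamma> * a + (norm (x - u))\<^sup>2 / 2 + (norm (v - u))\<^sup>2 / 2 \<le> \<gamma> * b + (norm (x - v))\<^sup>2 / 2"
    if "g v = ereal b" for v b
  proof -
    have "\<gamma> * (a + ((x - u) /\<^sub>R \<gamma>) \<bullet> (v - u)) \<le> \<gamma> * b"
      using subdiff_real[OF s a that] \<open>\<gamma> > 0\<close> by simp
    then have "\<gamma> * a + (x - u) \<bullet> (v - u) \<le> \<gamma> * b"
      using \<open>\<gamma> > 0\<close> by (simp add: distrib_left mult.assoc[symmetric])
    moreover have "(norm (x - v))\<^sup>2 = (norm (x - u))\<^sup>2 - 2 * ((x - u) \<bullet> (v - u)) + (norm (v - u))\<^sup>2"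
      using norm_diff_scaleR_power2[of "x - u" 1 "v - u"] by simp
    ultimately show ?thesis
      by (simp add: field_simps)
  qed
  show ?thesis
    unfolding prox_def
  proof (rule the_equality)
    show "\<forall>v. ereal \<gamma> * g u + ereal ((norm (x - u))\<^sup>2 / 2) \<le> ereal \<gamma> * g v + ereal ((norm (x - v))\<^sup>2 / 2)"
    proof
      fix v
      show "ereal \<gamma> * g u + ereal ((norm (x - u))\<^sup>2 / 2) \<le> ereal \<gamma> * g v + ereal ((norm (x - v))\<^sup>2 / 2)"
      proof (rule proper_fun_cases[OF pr, of v])
        fix b assume b: "g v = ereal b"
        have "\<gamma> * a + (norm (x - u))\<^sup>2 / 2 \<le> \<gamma> * b + (norm (x - v))\<^sup>2 / 2"
          using key[OF b] zero_le_power2[of "norm (v - u)"] by linarith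
        then show ?thesis
          using a b by simp
      qed (use \<open>\<gamma> > 0\<close> in simp)
    qed
  next
    fix w assume w: "\<forall>v. ereal \<gamma> * g w + ereal ((norm (x - w))\<^sup>2 / 2) \<le> ereal \<gamma> * g v + ereal ((norm (x - v))\<^sup>2 / 2)"
    then have wu: "ereal \<gamma> * g w + ereal ((norm (x - w))\<^sup>2 / 2) \<le> ereal (\<gamma> * a + (norm (x - u))\<^sup>2 / 2)"
      using a by (metis plus_ereal.simps(1) times_ereal.simps(1))
    then obtain b where b: "g w = ereal b"
      using proper_fun_cases[OF pr, of w] \<open>\<gamma> > 0\<close> by force
    have "(norm (w - u))\<^sup>2 \<le> 0"
    proof -
      have "\<gamma> * b + (norm (x - w))\<^sup>2 / 2 \<le> \<gamma> * a + (norm (x - u))\<^sup>2 / 2"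
        using wu b by simp
      then show ?thesis
        using key[OF b] by linarith
    qed
    then show "w = u"
      by simp
  qed
qed

lemma prox_eq_iff:
  fixes g :: "'a::euclidean_space \<Rightarrow> ereal"
  assumes "closed_fun g" "proper_fun g" "strongly_convex \<alpha> g" "\<alpha> > 0" "\<gamma> > 0"
  shows "prox (\<lambda>u. ereal \<gamma> * g u) x = u \<longleftrightarrow> (x - u) /\<^sub>R \<gamma> \<in> subdiff g u"
proof
  obtain w where w: "(x - w) /\<^sub>R \<gamma> \<in> subdiff g w"
    using prox_inclusion_exists[OF assms] .
  moreover assume "prox (\<lambda>u. ereal \<gamma> * g u) x = u"
  ultimately show "(x - u) /\<^sub>R \<gamma> \<in> subdiff g u"
    using prox_eqI[OF assms(2,5) w] by simp
qed (rule prox_eqI[OF assms(2,5)])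

text \<open>Strong monotonicity of the subdifferential at the two proximal points, rearranged and
  combined with Cauchy-Schwarz; the case \<open>u = v\<close> is split off because a factor
  \<open>norm (u - v)\<close> is cancelled.\<close>

lemma prox_contraction:
  fixes g :: "'a::euclidean_space \<Rightarrow> ereal"
  assumes "closed_fun g" "proper_fun g" "strongly_convex \<alpha> g" "\<alpha> > 0" "\<gamma> > 0"
  shows "(1 + \<gamma> * \<alpha>) * norm (prox (\<lambda>u. ereal \<gamma> * g u) x - prox (\<lambda>u. ereal \<gamma> * g u) y) \<le> norm (x - y)"
proof -
  define u v where "u = prox (\<lambda>u. ereal \<gamma> * g u) x" and "v = prox (\<lambda>u. ereal \<gamma> * g u) y"
  have "(x - u) /\<^sub>R \<gamma> \<in> subdiff g u" "(y - v) /\<^sub>R \<gamma> \<in> subdiff g v"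
    using prox_eq_iff[OF assms] u_def v_def by blast+
  then have "\<alpha> * (norm (u - v))\<^sup>2 \<le> ((x - u) /\<^sub>R \<gamma> - (y - v) /\<^sub>R \<gamma>) \<bullet> (u - v)"
    using assms by (intro subdiff_strongly_monotone) auto
  also have "\<dots> = ((x - y) - (u - v)) \<bullet> (u - v) / \<gamma>"
  proof -
    have "(x - u) /\<^sub>R \<gamma> - (y - v) /\<^sub>R \<gamma> = ((x - y) - (u - v)) /\<^sub>R \<gamma>"
      by (simp add: algebra_simps)
    then show ?thesis
      by (simp only: inner_scaleR_left) (simp add: divide_inverse)
  qed
  finally have "\<gamma> * \<alpha> * (norm (u - v))\<^sup>2 \<le> ((x - y) - (u - v)) \<bullet> (u - v)"
    using \<open>\<gamma> > 0\<close> by (simp add: field_simps)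
  then have "(1 + \<gamma> * \<alpha>) * (norm (u - v))\<^sup>2 \<le> (x - y) \<bullet> (u - v)"
    by (simp add: inner_diff_left power2_norm_eq_inner algebra_simps)
  also have "\<dots> \<le> norm (x - y) * norm (u - v)"
    by (rule norm_cauchy_schwarz)
  finally have *: "(1 + \<gamma> * \<alpha>) * norm (u - v) * norm (u - v) \<le> norm (x - y) * norm (u - v)"
    by (simp add: power2_eq_square mult_ac)
  show ?thesis
  proof (cases "u = v")
    case False
    then have "(1 + \<gamma> * \<alpha>) * norm (u - v) \<le> norm (x - y)"
      by (intro mult_right_le_imp_le[OF *]) simp
    then show ?thesis
      by (simp only: u_def v_def)
  qed (use u_def v_def in simp)
qed

section \<open>Auxiliary facts on Lipschitz maps and matrices\<close>

lemma loc_lipschitz_on_compose: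
  assumes F: "loc_lipschitz_on D F" and G: "loc_lipschitz_on E G" and FD: "F ` D \<subseteq> E"
  shows "loc_lipschitz_on D (\<lambda>x. G (F x))"
  unfolding loc_lipschitz_on_def
proof
  fix x assume x: "x \<in> D"
  obtain e1 L1 where 1: "e1 > 0" "L1-lipschitz_on (ball x e1 \<inter> D) F"
    using F x unfolding loc_lipschitz_on_def by blast
  obtain e2 L2 where 2: "e2 > 0" "L2-lipschitz_on (ball (F x) e2 \<inter> E) G"
    using G x FD unfolding loc_lipschitz_on_def by blast
  have L1: "L1 \<ge> 0"
    using 1(2) lipschitz_on_nonneg by blast
  \<comment> \<open>The image of the ball must stay within \<open>e2\<close> of \<open>F x\<close>;
    adding 1 avoids division by zero when \<open>L1 = 0\<close>.\<close>
  define e where "e = min e1 (e2 / (L1 + 1))"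
  have e: "e > 0" "e \<le> e1" "e \<le> e2 / (L1 + 1)"
    using 1 2 L1 by (auto simp: e_def)
  have lipF: "L1-lipschitz_on (ball x e \<inter> D) F"
    using 1(2) by (rule lipschitz_on_subset) (use e in auto)
  have "F ` (ball x e \<inter> D) \<subseteq> ball (F x) e2 \<inter> E"
  proof
    fix z assume "z \<in> F ` (ball x e \<inter> D)"
    then obtain y where y: "z = F y" "dist x y < e" "y \<in> D"
      by auto
    have "dist (F x) (F y) \<le> L1 * dist x y"
      using lipF x y e(1) by (intro lipschitz_onD[OF lipF]) auto
    also have "\<dots> \<le> (L1 + 1) * dist x y"
      by (intro mult_right_mono) auto
    also have "\<dots> < (L1 + 1) * (e2 / (L1 + 1))"
      using y(2) e(3) L1 by (intro mult_strict_left_mono) auto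
    also have "\<dots> = e2"
      using L1 by simp
    finally show "z \<in> ball (F x) e2 \<inter> E"
      using y FD by auto
  qed
  then have "L2-lipschitz_on (F ` (ball x e \<inter> D)) G"
    using 2(2) lipschitz_on_subset by blast
  then have "(L2 * L1)-lipschitz_on (ball x e \<inter> D) (\<lambda>x. G (F x))"
    using lipF by (rule lipschitz_on_compose2[rotated])
  then show "\<exists>e>0. \<exists>L. L-lipschitz_on (ball x e \<inter> D) (\<lambda>x. G (F x))"
    using e(1) by blast
qed

lemma loc_lipschitz_onI_norm:
  fixes F :: "'a::real_normed_vector \<Rightarrow> 'b::real_normed_vector"
  assumes "\<And>x. x \<in> D \<Longrightarrow> \<exists>e>0. \<exists>L\<ge>0. \<forall>y\<in>ball x e \<inter> D. \<forall>z\<in>ball x e \<inter> D. norm (F y - F z) \<le> L * norm (y - z)"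
  shows "loc_lipschitz_on D F"
  unfolding loc_lipschitz_on_def lipschitz_on_def dist_norm
  by (meson assms)

lemma loc_lipschitz_onD_norm:
  fixes F :: "'a::real_normed_vector \<Rightarrow> 'b::real_normed_vector"
  assumes "loc_lipschitz_on D F" "x \<in> D"
  obtains e L where "e > 0" "L \<ge> 0"
    "\<And>y z. y \<in> ball x e \<inter> D \<Longrightarrow> z \<in> ball x e \<inter> D \<Longrightarrow> norm (F y - F z) \<le> L * norm (y - z)"
proof -
  obtain e L where "e > 0" "L-lipschitz_on (ball x e \<inter> D) F"
    using assms unfolding loc_lipschitz_on_def by blast
  then show ?thesis
    using that[of e L] unfolding lipschitz_on_def dist_norm by blast
qed

lemma matrix_inv_left:
  fixes A :: "real^'n^'n"
  assumes "invertible A"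
  shows "matrix_inv A ** A = mat 1"
  using someI_ex[OF assms[unfolded invertible_def]] by (simp add: matrix_inv_def)

lemma matrix_inv_right:
  fixes A :: "real^'n^'n"
  assumes "invertible A"
  shows "A ** matrix_inv A = mat 1"
  using someI_ex[OF assms[unfolded invertible_def]] by (simp add: matrix_inv_def)

lemma norm_diff_vjoin [simp]:
  "norm (vjoin a z - vjoin b z) = norm (a - b)" "norm (vjoin c a - vjoin c b) = norm (a - b)"
  by (rule power2_eq_imp_eq; simp add: norm_vec_sum_power2)+

lemma vjoin_add_0: "w + t *\<^sub>R vjoin 0 v = vjoin (vfst w) (vsnd w + t *\<^sub>R v)"
  by (rule vec_sum_eqI) auto

lemma matrix_tendstoI:
  fixes X :: "nat \<Rightarrow> real^'a^'b"
  assumes "\<And>v. (\<lambda>n. X n *v v) \<longlonglongrightarrow> Y *v v"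
  shows "X \<longlonglongrightarrow> Y"
proof (intro vec_tendstoI)
  fix i j
  have "(\<lambda>n. (X n *v axis j 1) $ i) \<longlonglongrightarrow> (Y *v axis j 1) $ i"
    using assms by (intro tendsto_vec_nth)
  then show "(\<lambda>n. X n $ i $ j) \<longlonglongrightarrow> Y $ i $ j"
    by (simp add: matrix_vector_mult_basis column_def)
qed

lemma tendsto_mblockL: "X \<longlonglongrightarrow> M \<Longrightarrow> (\<lambda>n. mblockL (X n)) \<longlonglongrightarrow> mblockL M"
  unfolding mblockL_def by (intro tendsto_intros)

lemma tendsto_mblockR: "X \<longlonglongrightarrow> M \<Longrightarrow> (\<lambda>n. mblockR (X n)) \<longlonglongrightarrow> mblockR M"
  unfolding mblockR_def by (intro tendsto_intros)

section \<open>Saddle points as subgradient inclusions\<close>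

lemma saddle_point_iff_subdiff:
  assumes "proper_fun g" "proper_fun f"
  shows "saddle_point g K f x y \<longleftrightarrow> K *v x \<in> subdiff f y \<and> - (transpose K *v y) \<in> subdiff g x"
proof
  assume sp: "saddle_point g K f x y"
  obtain a b where ab: "g x = ereal a" "f y = ereal b"
    using sp unfolding saddle_point_def by (metis abs_neq_infinity_cases)
  have 1: "ereal a + ereal ((K *v x) \<bullet> y') - f y' \<le> ereal (a + (K *v x) \<bullet> y - b)" for y'
    using sp ab unfolding saddle_point_def by auto
  have 2: "ereal (a + (K *v x) \<bullet> y - b) \<le> g x' + ereal ((K *v x') \<bullet> y - b)" for x'
  proof -
    have "ereal (a + (K *v x) \<bullet> y - b) \<le> g x' + ereal ((K *v x') \<bullet> y) - ereal b"
      using sp ab unfolding saddle_point_def by auto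
    then show ?thesis
      by (cases "g x'") auto
  qed
  have "f y + ereal ((K *v x) \<bullet> (y' - y)) \<le> f y'" for y'
  proof (rule proper_fun_cases[OF assms(2), of y'])
    fix b' assume b': "f y' = ereal b'"
    then show ?thesis
      using 1[of y'] ab by (simp add: inner_diff_right)
  qed simp
  moreover have "g x + ereal (- (transpose K *v y) \<bullet> (x' - x)) \<le> g x'" for x'
  proof (rule proper_fun_cases[OF assms(1), of x'])
    fix a' assume a': "g x' = ereal a'"
    then show ?thesis
      using 2[of x'] ab by (simp add: inner_diff_right dot_lmul_matrix inner_commute[of y])
  qed simp
  ultimately show "K *v x \<in> subdiff f y \<and> - (transpose K *v y) \<in> subdiff g x"
    by (simp add: subdiff_def)
next
  assume *: "K *v x \<in> subdiff f y \<and> - (transpose K *v y) \<in> subdiff g x"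
  then obtain a b where ab: "g x = ereal a" "f y = ereal b"
    using subdiff_finite assms by metis
  have 1: "ereal a + ereal ((K *v x) \<bullet> y') - f y' \<le> ereal (a + (K *v x) \<bullet> y - b)" for y'
  proof (rule proper_fun_cases[OF assms(2), of y'])
    fix b' assume b': "f y' = ereal b'"
    show ?thesis
      using subdiff_real[OF _ ab(2) b', of "K *v x"] * b' by (simp add: inner_diff_right)
  qed simp
  have 2: "ereal (a + (K *v x) \<bullet> y - b) \<le> g x' + ereal ((K *v x') \<bullet> y) - ereal b" for x'
  proof (rule proper_fun_cases[OF assms(1), of x'])
    fix a' assume a': "g x' = ereal a'"
    have "a + - (transpose K *v y) \<bullet> (x' - x) \<le> a'"
      using subdiff_real[OF _ ab(1) a'] * by blast
    then show ?thesis
      using a' by (simp add: inner_diff_right dot_lmul_matrix inner_commute[of y])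
  qed simp
  show "saddle_point g K f x y"
    unfolding saddle_point_def using 1 2 by (simp add: ab)
qed

text \<open>For the transpose, with \<open>?w\<close> the image of \<open>y\<close>, the square of
  \<open>norm ?w\<close> equals \<open>y \<bullet> (K *v ?w)\<close>, which is at most
  \<open>\<beta> * norm y * norm ?w\<close>; one factor cancels.\<close>

lemma onorm_le_imp_norm_mult_le:
  fixes K :: "real^'n^'m"
  assumes "onorm (\<lambda>x. K *v x) \<le> \<beta>"
  shows "norm (K *v x) \<le> \<beta> * norm x" "norm (transpose K *v y) \<le> \<beta> * norm y"
proof -
  have le: "norm (K *v x) \<le> \<beta> * norm x" for x
    using onorm[of "\<lambda>x. K *v x" x] mult_right_mono[OF assms, of "norm x"] by (auto intro: order_trans)
  then show "norm (K *v x) \<le> \<beta> * norm x" .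
  let ?w = "transpose K *v y"
  have "norm ?w * norm ?w = y \<bullet> (K *v ?w)"
    by (simp add: dot_lmul_matrix[symmetric] power2_norm_eq_inner[symmetric] power2_eq_square)
  also have "\<dots> \<le> norm y * norm (K *v ?w)"
    by (rule norm_cauchy_schwarz)
  also have "\<dots> \<le> norm y * (\<beta> * norm ?w)"
    by (intro mult_left_mono le) auto
  finally have *: "norm ?w * norm ?w \<le> \<beta> * norm y * norm ?w"
    by (simp add: mult_ac)
  show "norm ?w \<le> \<beta> * norm y"
  proof (cases "?w = 0")
    case True
    have "0 \<le> \<beta>"
      using assms onorm_pos_le[of "\<lambda>x. K *v x"] by auto
    then show ?thesis
      by (simp only: True) simp
  next
    case False
    then show ?thesis
      by (intro mult_right_le_imp_le[OF *]) simp
  qed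
qed

section \<open>The parametric saddle point problem\<close>

locale primal_dual =
  fixes \<Theta> :: "(real^'p) set"
    and \<alpha> \<beta> \<gamma> :: real
    and g :: "real^'p \<Rightarrow> real^'n \<Rightarrow> ereal"
    and fs :: "real^'p \<Rightarrow> real^'m \<Rightarrow> ereal"
    and K :: "real^'p \<Rightarrow> real^'n^'m"
    and T B :: "real^('p + ('n + 'm)) \<Rightarrow> real^('n + 'm)"
    and zstar :: "real^'p \<Rightarrow> real^('n + 'm)"
  assumes \<Theta>_open: "open \<Theta>"
    and \<alpha>_pos: "\<alpha> > 0" and \<beta>_pos: "\<beta> > 0"
    and g_cl: "\<forall>\<theta>\<in>\<Theta>. closed_fun (g \<theta>) \<and> proper_fun (g \<theta>) \<and> strongly_convex \<alpha> (g \<theta>)"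
    and f_cl: "\<forall>\<theta>\<in>\<Theta>. closed_fun (fs \<theta>) \<and> proper_fun (fs \<theta>) \<and> strongly_convex \<alpha> (fs \<theta>)"
    and K_norm: "\<forall>\<theta>\<in>\<Theta>. onorm (\<lambda>x. K \<theta> *v x) \<le> \<beta>"
    and \<gamma>_pos: "0 < \<gamma>" and \<gamma>_lt: "\<gamma> < 2 * \<alpha> / (\<alpha> + \<beta>)\<^sup>2"
    and T_def: "T = (\<lambda>w. vjoin (prox (\<lambda>u. ereal \<gamma> * g (vfst w) u) (vfst (vsnd w)))
                        (prox (\<lambda>v. ereal \<gamma> * fs (vfst w) v) (vsnd (vsnd w))))"
    and B_def: "B = (\<lambda>w. vjoin (transpose (K (vfst w)) *v vsnd (vsnd w))
                        (- (K (vfst w) *v vfst (vsnd w))))"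
    and T_pd: "path_differentiable_on {w. vfst w \<in> \<Theta>} T"
    and B_pd: "path_differentiable_on {w. vfst w \<in> \<Theta>} B"
    and zstar_def: "zstar = (\<lambda>\<theta>. THE z. saddle_point (g \<theta>) (K \<theta>) (fs \<theta>) (vfst z) (vsnd z))"
begin

abbreviation D :: "(real^('p + ('n + 'm))) set" where "D \<equiv> {w. vfst w \<in> \<Theta>}"

text \<open>The parameter is carried along so that \<open>T\<close> can be composed with
  \<open>fwd\<close> as joint maps and the image curves stay in \<open>D\<close>.\<close>

definition fwd :: "real^('p + ('n + 'm)) \<Rightarrow> real^('p + ('n + 'm))" where
  "fwd w = vjoin (vfst w) (vsnd w - \<gamma> *\<^sub>R B w)"

definition q :: real where "q = sqrt (1 + \<gamma>\<^sup>2 * \<beta>\<^sup>2) / (1 + \<gamma> * \<alpha>)"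

lemma open_D: "open D"
proof -
  have "D = vfst -` \<Theta>" by auto
  moreover have "continuous_on UNIV (vfst :: real^('p + ('n + 'm)) \<Rightarrow> real^'p)"
    by (simp add: linear_vfst linear_continuous_on linear_conv_bounded_linear[symmetric])
  ultimately show ?thesis
    using \<Theta>_open by (simp add: open_vimage)
qed

lemma \<gamma>\<alpha>_pos: "1 + \<gamma> * \<alpha> > 0"
  using \<alpha>_pos \<gamma>_pos by (simp add: add_pos_pos)

text \<open>After squaring, \<open>q < 1\<close> reads \<open>\<gamma>\<^sup>2 * \<beta>\<^sup>2 < 2
  * \<gamma> * \<alpha> + \<gamma>\<^sup>2 * \<alpha>\<^sup>2\<close>, which follows from
  \<open>\<gamma> * \<beta>\<^sup>2 \<le> \<gamma> * (\<alpha> + \<beta>)\<^sup>2 < 2 *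
  \<alpha>\<close>.\<close>

lemma q_bounds: "0 \<le> q" "q < 1"
proof -
  show "0 \<le> q"
    using \<gamma>\<alpha>_pos by (simp add: q_def)
  have "\<gamma> * (\<alpha> + \<beta>)\<^sup>2 < 2 * \<alpha>"
    using \<gamma>_lt \<alpha>_pos \<beta>_pos by (simp add: field_simps)
  moreover have "\<beta>\<^sup>2 \<le> (\<alpha> + \<beta>)\<^sup>2"
    using \<alpha>_pos \<beta>_pos by (intro power_mono) auto
  then have "\<gamma> * \<beta>\<^sup>2 \<le> \<gamma> * (\<alpha> + \<beta>)\<^sup>2"
    using \<gamma>_pos by (intro mult_left_mono) auto
  ultimately have "\<gamma> * \<beta>\<^sup>2 < 2 * \<alpha>"
    by linarith
  then have "\<gamma> * (\<gamma> * \<beta>\<^sup>2) < \<gamma> * (2 * \<alpha>)"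
    using \<gamma>_pos by (intro mult_strict_left_mono) auto
  moreover have "0 \<le> (\<gamma> * \<alpha>)\<^sup>2"
    by simp
  ultimately have "1 + \<gamma>\<^sup>2 * \<beta>\<^sup>2 < (1 + \<gamma> * \<alpha>)\<^sup>2"
    by (simp add: power2_eq_square algebra_simps)
  then have "sqrt (1 + \<gamma>\<^sup>2 * \<beta>\<^sup>2) < 1 + \<gamma> * \<alpha>"
    using \<gamma>\<alpha>_pos by (intro real_less_lsqrt) auto
  then show "q < 1"
    using \<gamma>\<alpha>_pos by (simp add: q_def)
qed

section \<open>Contraction of the forward-backward map and its fixed point\<close>

lemma T_contraction:
  assumes "\<theta> \<in> \<Theta>"
  shows "(1 + \<gamma> * \<alpha>) * norm (T (vjoin \<theta> z) - T (vjoin \<theta> z')) \<le> norm (z - z')"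
proof (rule power2_le_imp_le)
  let ?d = "T (vjoin \<theta> z) - T (vjoin \<theta> z')"
  have "(1 + \<gamma> * \<alpha>) * norm (vfst ?d) \<le> norm (vfst z - vfst z')"
    "(1 + \<gamma> * \<alpha>) * norm (vsnd ?d) \<le> norm (vsnd z - vsnd z')"
    using assms g_cl f_cl \<alpha>_pos \<gamma>_pos by (auto simp: T_def intro!: prox_contraction)
  then have "((1 + \<gamma> * \<alpha>) * norm (vfst ?d))\<^sup>2 \<le> (norm (vfst z - vfst z'))\<^sup>2"
    "((1 + \<gamma> * \<alpha>) * norm (vsnd ?d))\<^sup>2 \<le> (norm (vsnd z - vsnd z'))\<^sup>2"
    using \<gamma>\<alpha>_pos by (auto intro!: power_mono)
  then show "((1 + \<gamma> * \<alpha>) * norm ?d)\<^sup>2 \<le> (norm (z - z'))\<^sup>2"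
    by (simp add: power_mult_distrib norm_vec_sum_power2[of ?d] norm_vec_sum_power2[of "z - z'"] distrib_left)
qed simp

lemma B_add: "B (vjoin \<theta> (z + z')) = B (vjoin \<theta> z) + B (vjoin \<theta> z')"
  by (rule vec_sum_eqI) (simp_all add: B_def algebra_simps vector_matrix_left_distrib)

lemma B_scaleR: "B (vjoin \<theta> (t *\<^sub>R z)) = t *\<^sub>R B (vjoin \<theta> z)"
  by (rule vec_sum_eqI) (simp_all add: B_def matrix_vector_mult_scaleR scaleR_vector_matrix_assoc)

lemma B_diff: "B (vjoin \<theta> (z - z')) = B (vjoin \<theta> z) - B (vjoin \<theta> z')"
  using B_add[of \<theta> "z - z'" z'] by simp

lemma B_skew: "z \<bullet> B (vjoin \<theta> z) = 0"
  by (simp add: B_def inner_vec_sum dot_lmul_matrix inner_commute[of "vfst z"])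

lemma norm_B_le:
  assumes "\<theta> \<in> \<Theta>"
  shows "norm (B (vjoin \<theta> z)) \<le> \<beta> * norm z"
proof (rule power2_le_imp_le)
  have "norm (transpose (K \<theta>) *v vsnd z) \<le> \<beta> * norm (vsnd z)" "norm (K \<theta> *v vfst z) \<le> \<beta> * norm (vfst z)"
    using onorm_le_imp_norm_mult_le K_norm assms by blast+
  then have "(norm (transpose (K \<theta>) *v vsnd z))\<^sup>2 \<le> (\<beta> * norm (vsnd z))\<^sup>2" "(norm (K \<theta> *v vfst z))\<^sup>2 \<le> (\<beta> * norm (vfst z))\<^sup>2"
    by (auto intro!: power_mono simp del: transpose_matrix_vector)
  then show "(norm (B (vjoin \<theta> z)))\<^sup>2 \<le> (\<beta> * norm z)\<^sup>2"
    by (simp add: norm_vec_sum_power2 power_mult_distrib B_def distrib_left)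
qed (use \<beta>_pos in simp)

lemma forward_step_norm_le:
  assumes "\<theta> \<in> \<Theta>"
  shows "norm (z - \<gamma> *\<^sub>R B (vjoin \<theta> z)) \<le> sqrt (1 + \<gamma>\<^sup>2 * \<beta>\<^sup>2) * norm z"
proof (rule power2_le_imp_le)
  have "(norm (B (vjoin \<theta> z)))\<^sup>2 \<le> (\<beta> * norm z)\<^sup>2"
    using norm_B_le[OF assms] by (intro power_mono) auto
  then have "\<gamma>\<^sup>2 * (norm (B (vjoin \<theta> z)))\<^sup>2 \<le> \<gamma>\<^sup>2 * (\<beta> * norm z)\<^sup>2"
    by (intro mult_left_mono) auto
  then show "(norm (z - \<gamma> *\<^sub>R B (vjoin \<theta> z)))\<^sup>2 \<le> (sqrt (1 + \<gamma>\<^sup>2 * \<beta>\<^sup>2) * norm z)\<^sup>2"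
    by (simp add: norm_diff_scaleR_power2 B_skew power_mult_distrib algebra_simps)
qed simp

lemma forward_backward_contraction:
  assumes "\<theta> \<in> \<Theta>"
  shows "norm (T (fwd (vjoin \<theta> z)) - T (fwd (vjoin \<theta> z'))) \<le> q * norm (z - z')"
proof -
  \<comment> \<open>Linearity of \<open>B\<close> in the point makes the difference of two forward
    steps the forward step of the difference, where skewness removes the cross term.\<close>
  have eq: "(z - \<gamma> *\<^sub>R B (vjoin \<theta> z)) - (z' - \<gamma> *\<^sub>R B (vjoin \<theta> z')) = (z - z') - \<gamma> *\<^sub>R B (vjoin \<theta> (z - z'))"
    by (simp add: B_diff algebra_simps)
  have "(1 + \<gamma> * \<alpha>) * norm (T (fwd (vjoin \<theta> z)) - T (fwd (vjoin \<theta> z')))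
      \<le> norm ((z - \<gamma> *\<^sub>R B (vjoin \<theta> z)) - (z' - \<gamma> *\<^sub>R B (vjoin \<theta> z')))"
    using T_contraction[OF assms] by (simp add: fwd_def)
  also have "\<dots> \<le> sqrt (1 + \<gamma>\<^sup>2 * \<beta>\<^sup>2) * norm (z - z')"
    unfolding eq by (rule forward_step_norm_le[OF assms])
  finally show ?thesis
    using \<gamma>\<alpha>_pos by (simp add: q_def field_simps)
qed

lemma fwd_vjoin:
  "fwd (vjoin \<theta> z) = vjoin \<theta> (vjoin (vfst z - \<gamma> *\<^sub>R (transpose (K \<theta>) *v vsnd z))
                                    (vsnd z + \<gamma> *\<^sub>R (K \<theta> *v vfst z)))"
  unfolding fwd_def by (auto simp: B_def intro!: vec_sum_eqI)

text \<open>In the proximal inclusion at the forward step the point itself cancels, and division by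
  \<open>\<gamma>\<close> leaves exactly the two saddle point inclusions.\<close>

lemma saddle_point_iff_fixed_point:
  assumes "\<theta> \<in> \<Theta>"
  shows "saddle_point (g \<theta>) (K \<theta>) (fs \<theta>) (vfst z) (vsnd z) \<longleftrightarrow> T (fwd (vjoin \<theta> z)) = z"
proof -
  have "T (fwd (vjoin \<theta> z)) = z \<longleftrightarrow>
      prox (\<lambda>u. ereal \<gamma> * g \<theta> u) (vfst z - \<gamma> *\<^sub>R (transpose (K \<theta>) *v vsnd z)) = vfst z
      \<and> prox (\<lambda>v. ereal \<gamma> * fs \<theta> v) (vsnd z + \<gamma> *\<^sub>R (K \<theta> *v vfst z)) = vsnd z"
    unfolding fwd_vjoin vec_sum_eq_iff[of _ z] by (simp add: T_def)
  also have "\<dots> \<longleftrightarrow> - (transpose (K \<theta>) *v vsnd z) \<in> subdiff (g \<theta>) (vfst z)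
      \<and> K \<theta> *v vfst z \<in> subdiff (fs \<theta>) (vsnd z)"
  proof -
    have "(vfst z - \<gamma> *\<^sub>R (transpose (K \<theta>) *v vsnd z) - vfst z) /\<^sub>R \<gamma> = - (transpose (K \<theta>) *v vsnd z)"
      "(vsnd z + \<gamma> *\<^sub>R (K \<theta> *v vfst z) - vsnd z) /\<^sub>R \<gamma> = K \<theta> *v vfst z"
      using \<gamma>_pos by auto
    then show ?thesis
      using assms g_cl f_cl \<alpha>_pos \<gamma>_pos prox_eq_iff by metis
  qed
  finally show ?thesis
    using saddle_point_iff_subdiff assms g_cl f_cl by blast
qed

lemma saddle_point_ex1:
  assumes "\<theta> \<in> \<Theta>"
  shows "\<exists>!z. saddle_point (g \<theta>) (K \<theta>) (fs \<theta>) (vfst z) (vsnd z)"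
proof -
  have "\<exists>!z. T (fwd (vjoin \<theta> z)) = z"
    using q_bounds forward_backward_contraction[OF assms]
    by (intro banach_fix_type[of q]) (auto simp: dist_norm)
  then show ?thesis
    by (simp add: saddle_point_iff_fixed_point[OF assms])
qed

lemma zstar_fixed_point:
  assumes "\<theta> \<in> \<Theta>"
  shows "T (fwd (vjoin \<theta> (zstar \<theta>))) = zstar \<theta>"
  using theI'[OF saddle_point_ex1[OF assms]] saddle_point_iff_fixed_point[OF assms]
  by (simp add: zstar_def)

section \<open>Lipschitz dependence of the saddle point on the parameter\<close>

lemma loc_lipschitz_T: "loc_lipschitz_on D T" and loc_lipschitz_B: "loc_lipschitz_on D B"
  using T_pd B_pd by (auto simp: path_differentiable_on_def)

lemma loc_lipschitz_fwd: "loc_lipschitz_on D fwd"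
proof (rule loc_lipschitz_onI_norm)
  fix x assume "x \<in> D"
  then obtain e L where e: "e > 0" "L \<ge> 0"
    "\<And>y z. y \<in> ball x e \<inter> D \<Longrightarrow> z \<in> ball x e \<inter> D \<Longrightarrow> norm (B y - B z) \<le> L * norm (y - z)"
    using loc_lipschitz_onD_norm[OF loc_lipschitz_B] by metis
  have "norm (fwd y - fwd z) \<le> (2 + \<gamma> * L) * norm (y - z)" if "y \<in> ball x e \<inter> D" "z \<in> ball x e \<inter> D" for y z
  proof -
    have "norm (fwd y - fwd z) \<le> norm (vfst (fwd y - fwd z)) + norm (vsnd (fwd y - fwd z))"
      by (rule norm_vec_sum_le)
    also have "vfst (fwd y - fwd z) = vfst (y - z)"
      by (simp add: fwd_def)
    also have "vsnd (fwd y - fwd z) = vsnd (y - z) - \<gamma> *\<^sub>R (B y - B z)"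
      by (simp add: fwd_def algebra_simps)
    also have "norm (vsnd (y - z) - \<gamma> *\<^sub>R (B y - B z)) \<le> norm (vsnd (y - z)) + \<gamma> * norm (B y - B z)"
      using norm_triangle_ineq4[of "vsnd (y - z)" "\<gamma> *\<^sub>R (B y - B z)"] \<gamma>_pos by simp
    also have "\<gamma> * norm (B y - B z) \<le> \<gamma> * (L * norm (y - z))"
      using e(3) that \<gamma>_pos by (intro mult_left_mono) auto
    finally show ?thesis
      using norm_vfst_le[of "y - z"] norm_vsnd_le[of "y - z"] by (simp add: algebra_simps)
  qed
  then show "\<exists>e>0. \<exists>L\<ge>0. \<forall>y\<in>ball x e \<inter> D. \<forall>z\<in>ball x e \<inter> D. norm (fwd y - fwd z) \<le> L * norm (y - z)"
    using e(1,2) \<gamma>_pos by (intro exI[of _ e] conjI exI[of _ "2 + \<gamma> * L"]) auto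
qed

lemma loc_lipschitz_T_fwd: "loc_lipschitz_on D (\<lambda>w. T (fwd w))"
  by (rule loc_lipschitz_on_compose[OF loc_lipschitz_fwd loc_lipschitz_T]) (auto simp: fwd_def)

text \<open>Inserting the map at parameter \<open>\<theta>\<close> and point
  \<open>zstar \<theta>'\<close> splits the difference into a contraction term, absorbed on the
  left, and a pure change of parameter at a fixed point.\<close>

lemma zstar_diff_le:
  assumes "\<theta> \<in> \<Theta>" "\<theta>' \<in> \<Theta>"
  shows "(1 - q) * norm (zstar \<theta> - zstar \<theta>')
    \<le> norm (T (fwd (vjoin \<theta> (zstar \<theta>'))) - T (fwd (vjoin \<theta>' (zstar \<theta>'))))"
proof -
  have "zstar \<theta> - zstar \<theta>' = (T (fwd (vjoin \<theta> (zstar \<theta>))) - T (fwd (vjoin \<theta> (zstar \<theta>'))))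
      + (T (fwd (vjoin \<theta> (zstar \<theta>'))) - T (fwd (vjoin \<theta>' (zstar \<theta>'))))"
    using zstar_fixed_point assms by simp
  then have "norm (zstar \<theta> - zstar \<theta>') \<le> norm (T (fwd (vjoin \<theta> (zstar \<theta>))) - T (fwd (vjoin \<theta> (zstar \<theta>'))))
      + norm (T (fwd (vjoin \<theta> (zstar \<theta>'))) - T (fwd (vjoin \<theta>' (zstar \<theta>'))))"
    by (metis norm_triangle_ineq)
  then show ?thesis
    using forward_backward_contraction[OF assms(1), of "zstar \<theta>" "zstar \<theta>'"] by (simp add: algebra_simps)
qed

text \<open>The Lipschitz bound of \<open>T\<close> after \<open>fwd\<close> is only local in
  parameter and point jointly, so closeness of \<open>zstar \<theta>'\<close> to
  \<open>zstar \<theta>\<^sub>0\<close> has to be secured before the bound can be used for two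
  general parameters.\<close>

lemma loc_lipschitz_zstar: "loc_lipschitz_on \<Theta> zstar"
proof (rule loc_lipschitz_onI_norm)
  fix \<theta>\<^sub>0 assume \<theta>\<^sub>0: "\<theta>\<^sub>0 \<in> \<Theta>"
  define w where "w = vjoin \<theta>\<^sub>0 (zstar \<theta>\<^sub>0)"
  have "w \<in> D"
    using \<theta>\<^sub>0 by (simp add: w_def)
  then obtain e L where e: "e > 0" "L \<ge> 0"
    "\<And>y z. y \<in> ball w e \<inter> D \<Longrightarrow> z \<in> ball w e \<inter> D \<Longrightarrow> norm (T (fwd y) - T (fwd z)) \<le> L * norm (y - z)"
    using loc_lipschitz_onD_norm[OF loc_lipschitz_T_fwd] by metis
  define c where "c = L / (1 - q)"
  have c: "c \<ge> 0"
    using e q_bounds by (simp add: c_def)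
  \<comment> \<open>With parameters within \<open>d\<close>, the parameter part and the saddle point
    part of the distance to \<open>w\<close> add up to less than
    \<open>d + c * d = e\<close>.\<close>
  define d where "d = e / (1 + c)"
  have d: "d > 0" "d \<le> e" "(1 + c) * d = e"
    using e c by (auto simp: d_def field_simps)
  have le: "norm (zstar \<theta> - zstar \<theta>') \<le> c * norm (\<theta> - \<theta>')"
    if "\<theta> \<in> \<Theta>" "\<theta>' \<in> \<Theta>" "vjoin \<theta> (zstar \<theta>') \<in> ball w e" "vjoin \<theta>' (zstar \<theta>') \<in> ball w e" for \<theta> \<theta>'
  proof -
    have "(1 - q) * norm (zstar \<theta> - zstar \<theta>') \<le> L * norm (vjoin \<theta> (zstar \<theta>') - vjoin \<theta>' (zstar \<theta>'))"
      using zstar_diff_le[OF that(1,2)] e(3)[of "vjoin \<theta> (zstar \<theta>')" "vjoin \<theta>' (zstar \<theta>')"] that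
      by auto
    then show ?thesis
      using q_bounds by (simp add: c_def field_simps)
  qed
  \<comment> \<open>Bootstrap: against \<open>\<theta>\<^sub>0\<close> both test points have point
    part \<open>zstar \<theta>\<^sub>0\<close>, so they are in the ball without prior continuity of
    \<open>zstar\<close>.\<close>
  have near: "norm (zstar \<theta> - zstar \<theta>\<^sub>0) \<le> c * norm (\<theta> - \<theta>\<^sub>0)" if "\<theta> \<in> ball \<theta>\<^sub>0 d \<inter> \<Theta>" for \<theta>
    using that d e(1) \<theta>\<^sub>0 by (intro le) (auto simp: w_def dist_norm)
  have mem: "vjoin \<theta> (zstar \<theta>') \<in> ball w e" if "\<theta> \<in> ball \<theta>\<^sub>0 d \<inter> \<Theta>" "\<theta>' \<in> ball \<theta>\<^sub>0 d \<inter> \<Theta>" for \<theta> \<theta>'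
  proof -
    have "norm (vjoin \<theta> (zstar \<theta>') - w) \<le> norm (\<theta> - \<theta>\<^sub>0) + norm (zstar \<theta>' - zstar \<theta>\<^sub>0)"
      using norm_vec_sum_le[of "vjoin \<theta> (zstar \<theta>') - w"] by (simp add: w_def)
    also have "\<dots> \<le> norm (\<theta> - \<theta>\<^sub>0) + c * norm (\<theta>' - \<theta>\<^sub>0)"
      using near[OF that(2)] by simp
    also have "\<dots> < d + c * d"
      using that c by (intro add_less_le_mono mult_left_mono) (auto simp: dist_norm norm_minus_commute)
    also have "\<dots> = e"
      using d(3) by (simp add: algebra_simps)
    finally show ?thesis
      by (simp add: dist_norm norm_minus_commute)
  qed
  show "\<exists>e>0. \<exists>L\<ge>0. \<forall>y\<in>ball \<theta>\<^sub>0 e \<inter> \<Theta>. \<forall>z\<in>ball \<theta>\<^sub>0 e \<inter> \<Theta>. norm (zstar y - zstar z) \<le> L * norm (y - z)"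
    using d(1) c le mem by (intro exI[of _ d] conjI exI[of _ c]) auto
qed

section \<open>The point blocks of the Clarke Jacobians of \<open>T\<close> and
  \<open>B\<close>\<close>

lemma clarke_jac_T_block:
  assumes "\<theta> \<in> \<Theta>" "M \<in> clarke_jac T (vjoin \<theta> u)"
  shows "(1 + \<gamma> * \<alpha>) * norm (mblockR M *v v) \<le> norm v"
proof -
  \<comment> \<open>The direction \<open>vjoin 0 v\<close> isolates the block and leaves the
    parameter unchanged, so the contraction at fixed parameter bounds the difference
    quotients.\<close>
  have "M *v vjoin 0 v \<in> cball 0 (norm v / (1 + \<gamma> * \<alpha>))"
  proof (rule clarke_jac_mult_in[OF open_D _ _ _ assms(2)])
    fix y t assume y: "y \<in> D" and t: "(t::real) > 0"
    have "(1 + \<gamma> * \<alpha>) * norm (T (y + t *\<^sub>R vjoin 0 v) - T y) \<le> t * norm v"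
      using T_contraction[of "vfst y" "vsnd y + t *\<^sub>R v" "vsnd y"] y t
      by (simp add: vjoin_add_0)
    then show "(T (y + t *\<^sub>R vjoin 0 v) - T y) /\<^sub>R t \<in> cball 0 (norm v / (1 + \<gamma> * \<alpha>))"
      using t \<gamma>\<alpha>_pos by (simp add: divide_simps mult_ac)
  qed (use assms in auto)
  then show ?thesis
    using \<gamma>\<alpha>_pos by (simp add: matrix_vector_mult_blocks field_simps)
qed

text \<open>By linearity in the point, difference quotients at \<open>y\<close> in direction
  \<open>vjoin 0 v\<close> equal \<open>B (vjoin (vfst y) v)\<close>. The parameter of
  \<open>y\<close> varies near \<open>\<theta>\<close>, so continuity of \<open>B\<close> in the
  parameter brings them within any \<open>\<epsilon>\<close> of
  \<open>B (vjoin \<theta> v)\<close>.\<close>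

lemma clarke_jac_B_block:
  assumes "\<theta> \<in> \<Theta>" "N \<in> clarke_jac B (vjoin \<theta> z)"
  shows "mblockR N *v v = B (vjoin \<theta> v)"
proof -
  have lin: "linear (\<lambda>y :: real^('p + ('n + 'm)). vjoin (vfst y) (0 :: real^('n + 'm)))"
    by (rule linearI) (auto intro: vec_sum_eqI)
  have cont: "continuous_on D (\<lambda>y. B (vjoin (vfst y) v))"
  proof (rule continuous_on_compose2[OF loc_lipschitz_on_continuous_on[OF loc_lipschitz_B open_D]])
    have "vjoin (vfst y) v = vjoin (vfst y) 0 + vjoin 0 v" for y :: "real^('p + ('n + 'm))"
      by (rule vec_sum_eqI) auto
    then show "continuous_on D (\<lambda>y. vjoin (vfst y) v)"
      by (simp only:) (intro continuous_intros linear_continuous_on lin[unfolded linear_conv_bounded_linear])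
  qed auto
  have "norm (N *v vjoin 0 v - B (vjoin \<theta> v)) \<le> \<epsilon>" if "\<epsilon> > 0" for \<epsilon>
  proof -
    define U where "U = D \<inter> (\<lambda>y. B (vjoin (vfst y) v)) -` ball (B (vjoin \<theta> v)) \<epsilon>"
    have "open U"
      unfolding U_def using cont open_D by (intro continuous_open_preimage) auto
    have "N *v vjoin 0 v \<in> cball (B (vjoin \<theta> v)) \<epsilon>"
    proof (rule clarke_jac_mult_in[OF \<open>open U\<close> _ _ _ assms(2)])
      fix y t assume y: "y \<in> U" and t: "(t::real) > 0"
      have "B (y + t *\<^sub>R vjoin 0 v) - B y = t *\<^sub>R B (vjoin (vfst y) v)"
        by (metis B_add B_scaleR add_diff_cancel_left' vjoin_add_0 vjoin_vfst_vsnd)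
      then show "(B (y + t *\<^sub>R vjoin 0 v) - B y) /\<^sub>R t \<in> cball (B (vjoin \<theta> v)) \<epsilon>"
        using y t by (auto simp: U_def)
    qed (use assms that in \<open>auto simp: U_def\<close>)
    then show ?thesis
      by (simp add: dist_norm norm_minus_commute)
  qed
  then have "norm (N *v vjoin 0 v - B (vjoin \<theta> v)) \<le> 0"
    by (rule field_le_epsilon[of _ 0, simplified])
  then show ?thesis
    by (simp add: matrix_vector_mult_blocks)
qed

section \<open>The implicit Jacobian formula\<close>

definition jac_zstar :: "real^'p \<Rightarrow> (real^'p^('n + 'm)) set" where
  "jac_zstar \<theta> = {matrix_inv (mat 1 - mblockR M ** (mat 1 - \<gamma> *\<^sub>R mblockR N))
                 ** (mblockL M - \<gamma> *\<^sub>R (mblockR M ** mblockL N)) | M N.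
               M \<in> clarke_jac T (fwd (vjoin \<theta> (zstar \<theta>))) \<and> N \<in> clarke_jac B (vjoin \<theta> (zstar \<theta>))}"

lemma fwd_eq_vjoin: "fwd (vjoin \<theta> z) = vjoin \<theta> (z - \<gamma> *\<^sub>R B (vjoin \<theta> z))"
  by (simp add: fwd_def)

lemma implicit_matrix_apply:
  fixes M :: "real^('p + ('n + 'm))^('n + 'm)"
  shows "(mat 1 - mblockR M ** (mat 1 - \<gamma> *\<^sub>R mblockR N)) *v v
      = v - mblockR M *v (v - \<gamma> *\<^sub>R (mblockR N *v v))"
    "(mblockL M - \<gamma> *\<^sub>R (mblockR M ** mblockL N)) *v u = mblockL M *v u - \<gamma> *\<^sub>R (mblockR M *v (mblockL N *v u))"
  by (simp_all add: matrix_vector_mult_diff_rdistrib matrix_vector_mul_assoc[symmetric] scaleR_matrix_vector_assoc[symmetric])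

text \<open>The two blocks satisfy the same estimates as backward and forward step, so their product
  shrinks by \<open>q\<close>; the reverse triangle inequality does the rest. The constant does not
  depend on \<open>M\<close> and \<open>N\<close>.\<close>

lemma implicit_matrix_lower_bound:
  assumes "\<theta> \<in> \<Theta>" "M \<in> clarke_jac T (fwd (vjoin \<theta> z))" "N \<in> clarke_jac B (vjoin \<theta> z')"
  shows "(1 - q) * norm v \<le> norm ((mat 1 - mblockR M ** (mat 1 - \<gamma> *\<^sub>R mblockR N)) *v v)"
proof -
  let ?y = "v - \<gamma> *\<^sub>R B (vjoin \<theta> v)"
  have eq: "(mat 1 - mblockR M ** (mat 1 - \<gamma> *\<^sub>R mblockR N)) *v v = v - mblockR M *v ?y"
    by (simp only: implicit_matrix_apply clarke_jac_B_block[OF assms(1,3)])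
  have "(1 + \<gamma> * \<alpha>) * norm (mblockR M *v ?y) \<le> norm ?y"
    using clarke_jac_T_block assms(1,2) unfolding fwd_eq_vjoin by blast
  also have "\<dots> \<le> sqrt (1 + \<gamma>\<^sup>2 * \<beta>\<^sup>2) * norm v"
    by (rule forward_step_norm_le[OF assms(1)])
  finally have "norm (mblockR M *v ?y) \<le> q * norm v"
    using \<gamma>\<alpha>_pos by (simp add: q_def field_simps)
  moreover have "norm v - norm (mblockR M *v ?y) \<le> norm (v - mblockR M *v ?y)"
    by (rule norm_triangle_ineq2)
  ultimately show ?thesis
    unfolding eq by (simp add: algebra_simps)
qed

lemma implicit_matrix_invertible:
  assumes "\<theta> \<in> \<Theta>" "M \<in> clarke_jac T (fwd (vjoin \<theta> z))" "N \<in> clarke_jac B (vjoin \<theta> z')"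
  shows "invertible (mat 1 - mblockR M ** (mat 1 - \<gamma> *\<^sub>R mblockR N))"
proof -
  have "v = 0" if "(mat 1 - mblockR M ** (mat 1 - \<gamma> *\<^sub>R mblockR N)) *v v = 0" for v
  proof -
    have "(1 - q) * norm v \<le> 0"
      using implicit_matrix_lower_bound[OF assms, of v] that by simp
    then show ?thesis
      using q_bounds by (simp add: mult_le_0_iff)
  qed
  then show ?thesis
    unfolding invertible_left_inverse matrix_left_invertible_ker by blast
qed

lemma conservative_T: "conservative_jac_on D T (clarke_jac T)"
  and conservative_B: "conservative_jac_on D B (clarke_jac B)"
  using clarke_jac_conservative T_pd B_pd open_D by blast+

lemma loc_lipschitz_graph: "loc_lipschitz_on \<Theta> (\<lambda>\<theta>. vjoin \<theta> (zstar \<theta>))"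
proof (rule loc_lipschitz_onI_norm)
  fix x assume "x \<in> \<Theta>"
  then obtain e L where e: "e > 0" "L \<ge> 0"
    "\<And>y z. y \<in> ball x e \<inter> \<Theta> \<Longrightarrow> z \<in> ball x e \<inter> \<Theta> \<Longrightarrow> norm (zstar y - zstar z) \<le> L * norm (y - z)"
    using loc_lipschitz_onD_norm[OF loc_lipschitz_zstar] by metis
  have "norm (vjoin y (zstar y) - vjoin z (zstar z)) \<le> (1 + L) * norm (y - z)"
    if "y \<in> ball x e \<inter> \<Theta>" "z \<in> ball x e \<inter> \<Theta>" for y z
    using norm_vec_sum_le[of "vjoin y (zstar y) - vjoin z (zstar z)"] e(3)[OF that] by (simp add: algebra_simps)
  then show "\<exists>e>0. \<exists>L\<ge>0. \<forall>y\<in>ball x e \<inter> \<Theta>. \<forall>z\<in>ball x e \<inter> \<Theta>.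
      norm (vjoin y (zstar y) - vjoin z (zstar z)) \<le> L * norm (y - z)"
    using e(1,2) by (intro exI[of _ e] conjI exI[of _ "1 + L"]) auto
qed

text \<open>With \<open>A\<close> the implicit matrix and \<open>C\<close> the right-hand side, the
  lower bound for \<open>A\<close> at index \<open>n\<close> estimates
  \<open>Xs n *v v - X *v v\<close> by the residual of the limit \<open>X\<close> in the
  \<open>n\<close>-th equation. That residual tends to 0, since \<open>A\<close> and
  \<open>C\<close> depend continuously on \<open>M\<close> and \<open>N\<close>.\<close>

lemma usco_jac_zstar: "usco_on \<Theta> jac_zstar"
proof (rule usco_onI)
  fix \<theta>\<^sub>0 ts Xs
  assume \<theta>\<^sub>0: "\<theta>\<^sub>0 \<in> \<Theta>" and ts: "\<And>n. ts n \<in> \<Theta>" "ts \<longlonglongrightarrow> \<theta>\<^sub>0" and Xs: "\<And>n. Xs n \<in> jac_zstar (ts n)"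
  let ?w = "\<lambda>\<theta>. vjoin \<theta> (zstar \<theta>)"
  have "\<exists>M N. Xs n = matrix_inv (mat 1 - mblockR M ** (mat 1 - \<gamma> *\<^sub>R mblockR N))
                 ** (mblockL M - \<gamma> *\<^sub>R (mblockR M ** mblockL N))
      \<and> M \<in> clarke_jac T (fwd (?w (ts n))) \<and> N \<in> clarke_jac B (?w (ts n))" for n
    using Xs[of n] by (auto simp: jac_zstar_def)
  then obtain Ms Ns where MN: "\<And>n. Ms n \<in> clarke_jac T (fwd (?w (ts n)))" "\<And>n. Ns n \<in> clarke_jac B (?w (ts n))"
    and Xs_eq: "\<And>n. Xs n = matrix_inv (mat 1 - mblockR (Ms n) ** (mat 1 - \<gamma> *\<^sub>R mblockR (Ns n)))
                 ** (mblockL (Ms n) - \<gamma> *\<^sub>R (mblockR (Ms n) ** mblockL (Ns n)))"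
    by metis
  have cw: "continuous_on \<Theta> ?w"
    by (rule loc_lipschitz_on_continuous_on[OF loc_lipschitz_graph \<Theta>_open])
  have w_lim: "(\<lambda>n. ?w (ts n)) \<longlonglongrightarrow> ?w \<theta>\<^sub>0"
    by (rule continuous_on_tendsto_compose[OF cw ts(2) \<theta>\<^sub>0]) (use ts(1) in auto)
  have f_lim: "(\<lambda>n. fwd (?w (ts n))) \<longlonglongrightarrow> fwd (?w \<theta>\<^sub>0)"
    by (rule continuous_on_tendsto_compose[OF loc_lipschitz_on_continuous_on[OF loc_lipschitz_fwd open_D] w_lim])
       (use ts(1) \<theta>\<^sub>0 in auto)
  have wD: "?w \<theta> \<in> D" "fwd (?w \<theta>) \<in> D" if "\<theta> \<in> \<Theta>" for \<theta>
    using that by (auto simp: fwd_def)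
  have usT: "usco_on D (clarke_jac T)" and usB: "usco_on D (clarke_jac B)"
    using conservative_T conservative_B by (auto simp: conservative_jac_on_iff)
  \<comment> \<open>Two successive extractions: first for the elements of the Jacobian of
    \<open>T\<close>, then along that subsequence for those of \<open>B\<close>.\<close>
  obtain r1 M where r1: "strict_mono r1" "M \<in> clarke_jac T (fwd (?w \<theta>\<^sub>0))" "(Ms \<circ> r1) \<longlonglongrightarrow> M"
    using usco_on_subseq[OF usT wD(2)[OF \<theta>\<^sub>0] wD(2)[OF ts(1)] f_lim MN(1)] .
  have "((\<lambda>n. ?w (ts n)) \<circ> r1) \<longlonglongrightarrow> ?w \<theta>\<^sub>0"
    using w_lim r1(1) by (rule LIMSEQ_subseq_LIMSEQ)
  then obtain r2 N where r2: "strict_mono r2" "N \<in> clarke_jac B (?w \<theta>\<^sub>0)" "((Ns \<circ> r1) \<circ> r2) \<longlonglongrightarrow> N"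
    using usco_on_subseq[OF usB wD(1)[OF \<theta>\<^sub>0], of "(\<lambda>n. ?w (ts n)) \<circ> r1" "Ns \<circ> r1"] wD(1) ts(1) MN(2) by auto
  define r where "r = r1 \<circ> r2"
  have r: "strict_mono r"
    using r1(1) r2(1) by (simp add: r_def strict_mono_o)
  have Mlim: "(\<lambda>n. Ms (r n)) \<longlonglongrightarrow> M" and Nlim: "(\<lambda>n. Ns (r n)) \<longlonglongrightarrow> N"
    using LIMSEQ_subseq_LIMSEQ[OF r1(3) r2(1)] r2(3) by (auto simp: r_def o_def)
  define A where "A = (\<lambda>(M :: real^('p + ('n + 'm))^('n + 'm)) (N :: real^('p + ('n + 'm))^('n + 'm)).
      mat 1 - mblockR M ** (mat 1 - \<gamma> *\<^sub>R mblockR N))"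
  define C where "C = (\<lambda>(M :: real^('p + ('n + 'm))^('n + 'm)) (N :: real^('p + ('n + 'm))^('n + 'm)).
      mblockL M - \<gamma> *\<^sub>R (mblockR M ** mblockL N))"
  define X where "X = matrix_inv (A M N) ** C M N"
  have X: "X \<in> jac_zstar \<theta>\<^sub>0"
    using r1(2) r2(2) unfolding X_def A_def C_def jac_zstar_def by blast
  have AX: "A M N *v (X *v v) = C M N *v v" for v
    using matrix_inv_right[OF implicit_matrix_invertible[OF \<theta>\<^sub>0 r1(2) r2(2)]]
    by (simp add: X_def A_def matrix_vector_mul_assoc matrix_mul_assoc)
  have AXs: "A (Ms n) (Ns n) *v (Xs n *v v) = C (Ms n) (Ns n) *v v" for n v
    using matrix_inv_right[OF implicit_matrix_invertible[OF ts(1) MN(1) MN(2), of n]]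
    by (simp add: Xs_eq A_def C_def matrix_vector_mul_assoc matrix_mul_assoc)
  have "(\<lambda>n. Xs (r n)) \<longlonglongrightarrow> X"
  proof (rule matrix_tendstoI)
    fix v
    have "(\<lambda>n. C (Ms (r n)) (Ns (r n)) *v v - A (Ms (r n)) (Ns (r n)) *v (X *v v))
        \<longlonglongrightarrow> C M N *v v - A M N *v (X *v v)"
      unfolding A_def C_def implicit_matrix_apply
      by (intro tendsto_intros tendsto_mblockL tendsto_mblockR Mlim Nlim)
    then have lim: "(\<lambda>n. norm (C (Ms (r n)) (Ns (r n)) *v v - A (Ms (r n)) (Ns (r n)) *v (X *v v)) / (1 - q)) \<longlonglongrightarrow> 0"
      unfolding AX by (intro tendsto_divide_zero tendsto_norm_zero) simp
    have le: "norm (Xs (r n) *v v - X *v v)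
        \<le> norm (C (Ms (r n)) (Ns (r n)) *v v - A (Ms (r n)) (Ns (r n)) *v (X *v v)) / (1 - q)" for n
    proof -
      have "(1 - q) * norm (Xs (r n) *v v - X *v v)
          \<le> norm (A (Ms (r n)) (Ns (r n)) *v (Xs (r n) *v v - X *v v))"
        unfolding A_def by (rule implicit_matrix_lower_bound[OF ts(1) MN(1) MN(2)])
      then show ?thesis
        using q_bounds by (simp add: matrix_vector_mult_diff_distrib AXs field_simps)
    qed
    have "(\<lambda>n. Xs (r n) *v v - X *v v) \<longlonglongrightarrow> 0"
      by (rule Lim_null_comparison[OF always_eventually lim]) (rule allI, rule le)
    then show "(\<lambda>n. Xs (r n) *v v) \<longlonglongrightarrow> X *v v"
      by (rule LIM_zero_cancel)
  qed
  then show "\<exists>r M. strict_mono (r :: nat \<Rightarrow> nat) \<and> M \<in> jac_zstar \<theta>\<^sub>0 \<and> (Xs \<circ> r) \<longlonglongrightarrow> M"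
    using r X by (auto simp: o_def)
qed

text \<open>Solving the linearized fixed point equation: in block form it reads
  \<open>?A *v z' = ?C *v u\<close>, and \<open>?A\<close> is invertible. Since the equation is
  assumed for every pair \<open>M\<close>, \<open>N\<close>, it applies to the pair that defines
  \<open>X\<close>.\<close>

lemma jac_zstar_apply:
  assumes "\<theta> \<in> \<Theta>" "X \<in> jac_zstar \<theta>"
    and z': "\<And>M N. M \<in> clarke_jac T (fwd (vjoin \<theta> (zstar \<theta>))) \<Longrightarrow> N \<in> clarke_jac B (vjoin \<theta> (zstar \<theta>)) \<Longrightarrow>
      z' = M *v vjoin u (z' - \<gamma> *\<^sub>R (N *v vjoin u z'))"
  shows "X *v u = z'"
proof -
  obtain M N where X: "X = matrix_inv (mat 1 - mblockR M ** (mat 1 - \<gamma> *\<^sub>R mblockR N))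
                 ** (mblockL M - \<gamma> *\<^sub>R (mblockR M ** mblockL N))"
    and MN: "M \<in> clarke_jac T (fwd (vjoin \<theta> (zstar \<theta>)))" "N \<in> clarke_jac B (vjoin \<theta> (zstar \<theta>))"
    using assms(2) unfolding jac_zstar_def by blast
  let ?A = "mat 1 - mblockR M ** (mat 1 - \<gamma> *\<^sub>R mblockR N)"
  let ?C = "mblockL M - \<gamma> *\<^sub>R (mblockR M ** mblockL N)"
  have "z' = mblockL M *v u + mblockR M *v (z' - \<gamma> *\<^sub>R (mblockL N *v u + mblockR N *v z'))"
    using z'[OF MN] by (simp add: matrix_vector_mult_blocks)
  then have "?A *v z' = ?C *v u"
    unfolding implicit_matrix_apply by (simp add: algebra_simps)
  then have "matrix_inv ?A *v (?A *v z') = X *v u"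
    by (simp add: X matrix_vector_mul_assoc)
  then show ?thesis
    using matrix_inv_left[OF implicit_matrix_invertible[OF assms(1) MN]]
    by (simp only: matrix_vector_mul_assoc) simp
qed

text \<open>The chain rule for \<open>B\<close> is used along the lifted curve \<open>w\<close> and
  the one for \<open>T\<close> along its forward image. Off a null set both hold, and the fixed
  point equation identifies \<open>T\<close> along the second curve with \<open>zstar\<close> along
  \<open>c\<close>.\<close>

lemma zstar_curve:
  assumes c: "abs_continuous_curve c" "c ` {0..1} \<subseteq> \<Theta>"
  shows "AE t in lebesgue_on {0..1}. \<exists>c'. (c has_vector_derivative c') (at t)
               \<and> (\<forall>X\<in>jac_zstar (c t). ((zstar \<circ> c) has_vector_derivative (X *v c')) (at t))"
proof -
  define w where "w = (\<lambda>\<theta>. vjoin \<theta> (zstar \<theta>)) \<circ> c"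
  have w: "abs_continuous_curve w" "w ` {0..1} \<subseteq> D"
    using abs_continuous_curve_loc_lipschitz[OF loc_lipschitz_graph c] c(2) by (auto simp: w_def)
  have fw: "abs_continuous_curve (fwd \<circ> w)" "(fwd \<circ> w) ` {0..1} \<subseteq> D"
    using abs_continuous_curve_loc_lipschitz[OF loc_lipschitz_fwd w] w(2) by (auto simp: fwd_def)
  have "AE t in lebesgue_on {0..1}. \<exists>w'. (w has_vector_derivative w') (at t)
      \<and> (\<forall>N\<in>clarke_jac B (w t). ((B \<circ> w) has_vector_derivative (N *v w')) (at t))"
    using conservative_B w unfolding conservative_jac_on_def by blast
  moreover have "AE t in lebesgue_on {0..1}. \<exists>w'. ((fwd \<circ> w) has_vector_derivative w') (at t)
      \<and> (\<forall>M\<in>clarke_jac T ((fwd \<circ> w) t). ((T \<circ> (fwd \<circ> w)) has_vector_derivative (M *v w')) (at t))"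
    using conservative_T fw unfolding conservative_jac_on_def by blast
  \<comment> \<open>The derivatives are two-sided, while the fixed point equation is available only
    where \<open>c\<close> is known to lie in \<open>\<Theta>\<close>; the endpoints are therefore
    discarded.\<close>
  moreover have "AE t in lebesgue_on {0..1}. t \<in> {0<..<1::real}"
  proof -
    have "{0, 1::real} \<in> null_sets lebesgue"
      using negligible_iff_null_sets negligible_finite by blast
    then have "AE t in lebesgue. t \<notin> {0, 1::real}"
      by (rule AE_not_in)
    then have "AE t in lebesgue. t \<in> {0..1} \<longrightarrow> t \<in> {0<..<1::real}"
      by eventually_elim auto
    then show ?thesis
      by (subst AE_restrict_space_iff) auto
  qed
  ultimately show ?thesis
  proof eventually_elim
    case (elim t)
    then obtain w' f' where w': "(w has_vector_derivative w') (at t)"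
        "\<forall>N\<in>clarke_jac B (w t). ((B \<circ> w) has_vector_derivative (N *v w')) (at t)"
      and f': "((fwd \<circ> w) has_vector_derivative f') (at t)"
        "\<forall>M\<in>clarke_jac T ((fwd \<circ> w) t). ((T \<circ> (fwd \<circ> w)) has_vector_derivative (M *v f')) (at t)"
      by blast
    have t: "t \<in> {0<..<1}" "c t \<in> \<Theta>"
      using elim c(2) by auto
    define z' where "z' = vsnd w'"
    have vf: "((\<lambda>t. vfst (x t)) has_vector_derivative vfst x') (at t)"
      and vs: "((\<lambda>t. vsnd (x t)) has_vector_derivative vsnd x') (at t)"
      if "(x has_vector_derivative x') (at t)" for x and x' :: "real^('p + ('n + 'm))"
      using bounded_linear.has_vector_derivative[OF _ that] linear_vfst linear_vsnd
      by (auto simp: linear_conv_bounded_linear)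
    have dc: "(c has_vector_derivative vfst w') (at t)"
      using vf[OF w'(1)] by (simp add: w_def o_def)
    have dz: "((zstar \<circ> c) has_vector_derivative z') (at t)"
      using vs[OF w'(1)] by (simp add: w_def o_def z'_def)
    have dT: "((T \<circ> (fwd \<circ> w)) has_vector_derivative z') (at t)"
    proof (rule has_vector_derivative_transform_within_open[OF dz, of "{0<..<1}"])
      fix s :: real assume "s \<in> {0<..<1}"
      then have "c s \<in> \<Theta>"
        using c(2) by auto
      then show "(zstar \<circ> c) s = (T \<circ> (fwd \<circ> w)) s"
        using zstar_fixed_point by (simp add: w_def)
    qed (use t in auto)
    have "X *v vfst w' = z'" if "X \<in> jac_zstar (c t)" for X
    proof (rule jac_zstar_apply[OF t(2) that])
      fix M N
      assume M: "M \<in> clarke_jac T (fwd (vjoin (c t) (zstar (c t))))" and N: "N \<in> clarke_jac B (vjoin (c t) (zstar (c t)))"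
      \<comment> \<open>The velocity \<open>f'\<close> of the forward curve is computed blockwise.
        This works for each admissible \<open>N\<close>, because \<open>N *v w'\<close> is the
        derivative of \<open>B\<close> along \<open>w\<close> for all of them.\<close>
      have "((\<lambda>s. vsnd ((fwd \<circ> w) s)) has_vector_derivative (z' - \<gamma> *\<^sub>R (N *v w'))) (at t)"
      proof -
        have "((\<lambda>s. (zstar \<circ> c) s - \<gamma> *\<^sub>R (B \<circ> w) s) has_vector_derivative (z' - \<gamma> *\<^sub>R (N *v w'))) (at t)"
          using w'(2) N dz
          by (intro has_vector_derivative_diff bounded_linear.has_vector_derivative[OF bounded_linear_scaleR_right])
             (auto simp: w_def o_def)
        then show ?thesis
          by (simp add: fwd_def w_def o_def)
      qed
      then have "vsnd f' = z' - \<gamma> *\<^sub>R (N *v w')"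
        using vs[OF f'(1)] vector_derivative_unique_at by blast
      moreover have "vfst f' = vfst w'"
      proof -
        have "((\<lambda>s. vfst ((fwd \<circ> w) s)) has_vector_derivative vfst w') (at t)"
          using dc by (simp add: fwd_def w_def o_def)
        then show ?thesis
          using vf[OF f'(1)] vector_derivative_unique_at by blast
      qed
      ultimately have "f' = vjoin (vfst w') (z' - \<gamma> *\<^sub>R (N *v vjoin (vfst w') z'))"
        by (intro vec_sum_eqI) (auto simp: z'_def)
      moreover have "M *v f' = z'"
        using f'(2) M dT vector_derivative_unique_at by (force simp: w_def)
      ultimately show "z' = M *v vjoin (vfst w') (z' - \<gamma> *\<^sub>R (N *v vjoin (vfst w') z'))"
        by simp
    qed
    then show ?case
      using dc dz by (intro exI[of _ "vfst w'"]) auto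
  qed
qed

lemma conservative_jac_zstar: "conservative_jac_on \<Theta> zstar jac_zstar"
  unfolding conservative_jac_on_iff
proof (intro conjI ballI allI impI)
  fix \<theta> assume "\<theta> \<in> \<Theta>"
  then have "vjoin \<theta> (zstar \<theta>) \<in> D" "fwd (vjoin \<theta> (zstar \<theta>)) \<in> D"
    by (auto simp: fwd_def)
  then show "jac_zstar \<theta> \<noteq> {}"
    using conservative_T conservative_B unfolding conservative_jac_on_def jac_zstar_def by blast
qed (use usco_jac_zstar zstar_curve in blast)+

end

theorem theorem8:
  fixes \<Theta> :: "(real^'p) set"
    and \<alpha> \<beta> \<gamma> :: real
    and g :: "real^'p \<Rightarrow> real^'n \<Rightarrow> ereal"
    and fs :: "real^'p \<Rightarrow> real^'m \<Rightarrow> ereal"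
    and K :: "real^'p \<Rightarrow> real^'n^'m"
  assumes \<Theta>_ne: "\<Theta> \<noteq> {}" and \<Theta>_conn: "connected \<Theta>" and \<Theta>_open: "open \<Theta>"
    and \<alpha>_pos: "\<alpha> > 0" and \<beta>_pos: "\<beta> > 0"
    and g_cl: "\<forall>\<theta>\<in>\<Theta>. closed_fun (g \<theta>) \<and> proper_fun (g \<theta>) \<and> strongly_convex \<alpha> (g \<theta>)"
    and f_cl: "\<forall>\<theta>\<in>\<Theta>. closed_fun (fs \<theta>) \<and> proper_fun (fs \<theta>) \<and> strongly_convex \<alpha> (fs \<theta>)"
    and K_norm: "\<forall>\<theta>\<in>\<Theta>. 0 < onorm (\<lambda>x. K \<theta> *v x) \<and> onorm (\<lambda>x. K \<theta> *v x) \<le> \<beta>"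
    and \<gamma>_pos: "0 < \<gamma>" and \<gamma>_lt: "\<gamma> < 2 * \<alpha> / (\<alpha> + \<beta>)\<^sup>2"
    and T_def: "T = (\<lambda>w :: real^('p + ('n + 'm)).
                  vjoin (prox (\<lambda>u. ereal \<gamma> * g (vfst w) u) (vfst (vsnd w)))
                        (prox (\<lambda>v. ereal \<gamma> * fs (vfst w) v) (vsnd (vsnd w))))"
    and B_def: "B = (\<lambda>w :: real^('p + ('n + 'm)).
                  vjoin (transpose (K (vfst w)) *v vsnd (vsnd w))
                        (- (K (vfst w) *v vfst (vsnd w))))"
    and T_pd: "path_differentiable_on {w. vfst w \<in> \<Theta>} T"
    and B_pd: "path_differentiable_on {w. vfst w \<in> \<Theta>} B"
    and zstar_def: "zstar = (\<lambda>\<theta>. THE z :: real^('n + 'm).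
                       saddle_point (g \<theta>) (K \<theta>) (fs \<theta>) (vfst z) (vsnd z))"
  shows "(\<forall>\<theta>\<in>\<Theta>. \<exists>!z :: real^('n + 'm). saddle_point (g \<theta>) (K \<theta>) (fs \<theta>) (vfst z) (vsnd z))
    \<and> (\<forall>\<theta>\<in>\<Theta>. \<forall>x y. saddle_point (g \<theta>) (K \<theta>) (fs \<theta>) x y \<longleftrightarrow>
          (K \<theta> *v x \<in> subdiff (fs \<theta>) y \<and> - (transpose (K \<theta>) *v y) \<in> subdiff (g \<theta>) x))
    \<and> path_differentiable_on \<Theta> zstar
    \<and> conservative_jac_on \<Theta> zstar
        (\<lambda>\<theta>. {matrix_inv (mat 1 - mblockR M ** (mat 1 - \<gamma> *\<^sub>R mblockR N))
                 ** (mblockL M - \<gamma> *\<^sub>R (mblockR M ** mblockL N)) | M N.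
               M \<in> clarke_jac T (vjoin \<theta> (vjoin (vfst (zstar \<theta>) - \<gamma> *\<^sub>R (transpose (K \<theta>) *v vsnd (zstar \<theta>)))
                                               (vsnd (zstar \<theta>) + \<gamma> *\<^sub>R (K \<theta> *v vfst (zstar \<theta>)))))
             \<and> N \<in> clarke_jac B (vjoin \<theta> (zstar \<theta>))})"
proof -
  interpret primal_dual \<Theta> \<alpha> \<beta> \<gamma> g fs K T B zstar
    by unfold_locales (use assms in auto)
  have "conservative_jac_on \<Theta> zstar jac_zstar" "loc_lipschitz_on \<Theta> zstar"
    by (rule conservative_jac_zstar loc_lipschitz_zstar)+
  moreover have "\<forall>\<theta>\<in>\<Theta>. \<forall>x y. saddle_point (g \<theta>) (K \<theta>) (fs \<theta>) x y \<longleftrightarrow>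
      (K \<theta> *v x \<in> subdiff (fs \<theta>) y \<and> - (transpose (K \<theta>) *v y) \<in> subdiff (g \<theta>) x)"
    using g_cl f_cl saddle_point_iff_subdiff by blast
  \<comment> \<open>Unfolding \<open>fwd_vjoin\<close> rewrites the base point of the Clarke
    Jacobian of \<open>T\<close> into its explicit primal and dual components.\<close>
  ultimately show ?thesis
    using saddle_point_ex1
    unfolding path_differentiable_on_def jac_zstar_def[abs_def] fwd_vjoin by blast
qed

end
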